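(* Let $k$ be a commutative ring and let $\mathcal{A}$ be a left Auslander-Reiten $k$-category (in particular Krull-Schmidt). Let $f\colon X\to Y$ be a morphism in $\mathcal{A}$ and let $\mathcal{I}$ be an admissible ideal of $\mathcal{A}$. Suppose $X=\bigoplus_{i=1}^{n}X_i$ and $Y=\bigoplus_{j=1}^{m}Y_j$ are decompositions into indecomposables in $\mathcal{A}$ with $1_{X_i}\notin\mathcal{I}(X_i,X_i)$ and $1_{Y_j}\notin\mathcal{I}(Y_j,Y_j)$ for all $i,j$. Then $\overline{f}=f+\mathcal{I}(X,Y)\colon X\to Y$ is irreducible and right almost split in $\mathcal{A}/\mathcal{I}$ if and only if there exists $g\colon X'\to Y$ in $\mathcal{A}$ with $1_{X'}\in\mathcal{I}(X',X')$ such that $\begin{pmatrix}f& g\end{pmatrix}\colon X\oplus X'\to Y$ is minimal right almost split in $\mathcal{A}$.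
   Context: A $k$-category is an additive category whose Hom-sets are $k$-modules and whose composition is $k$-bilinear. An additive category is Krull-Schmidt if every object is a finite direct sum of objects with local endomorphism rings. Ideals are two-sided ideals of morphisms; $\mathcal{A}/\mathcal{I}$ has the same objects as $\mathcal{A}$ and Hom-modules $\operatorname{Hom}_{\mathcal{A}}(X,Y)/\mathcal{I}(X,Y)$. A section is a morphism with a left inverse and a retraction is a morphism with a right inverse. A morphism $f\colon X\to Y$ is right almost split if it is not a retraction and every non-retraction $u\colon U\to Y$ factors as $u=f\hat u$ for some $\hat u\colon U\to X$; it is right minimal if $fg=f$ with $g\colon X\to X$ implies $g$ is an automorphism; it is minimal right almost split if both hold. Minimal left almost split is defined dually. A morphism $f$ is irreducible if it is neither a section nor a retraction, and whenever $f=hg$, either $h$ is a retraction or $g$ is a section. A weak kernel of $f\colon X\to Y$ is a morphism $w\colon W\to X$ with $fw=0$ such that every $g\colon V\to X$ with $fg=0$ factors (not necessarily uniquely) through $w$; weak cokernels are dual. An Auslander-Reiten sequence is a sequence $X\xrightarrow{f}Y\xrightarrow{g}Z$ such that $f$ is a weak kernel of $g$, $g$ is a weak cokernel of $f$, $f$ is minimal left almost split, and $g$ is minimal right almost split (the middle term is allowed to be zero). An object $Z$ is pseudo-projective if there exists a minimal right almost split monomorphism $W\to Z$. A Krull-Schmidt $k$-category is a left Auslander-Reiten category if every indecomposable object $Z$ is either pseudo-projective or the last term of an Auslander-Reiten sequence. The radical is $\operatorname{rad}_{\mathcal{A}}(X,Y)=\{f\in\operatorname{Hom}_{\mathcal{A}}(X,Y)\mid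 1_X-gf\text{ is invertible for all }g\colon Y\to X\}$, and $\operatorname{rad}^2_{\mathcal{A}}(X,Y)$ is the $k$-submodule of $\operatorname{Hom}_{\mathcal{A}}(X,Y)$ generated by compositions of two radical morphisms. An ideal $\mathcal{I}$ is admissible if: (1) whenever $X,Y$ are indecomposable with $1_X\notin\mathcal{I}(X,X)$ and $1_Y\notin\mathcal{I}(Y,Y)$, then $\mathcal{I}(X,Y)\subseteq\operatorname{rad}^2_{\mathcal{A}}(X,Y)$; (2) if $f\colon X\to Y$ is minimal left almost split with $1_X\notin\mathcal{I}(X,X)$ and $g\in\mathcal{I}(X,M)$, then $g=hf$ for some $h\in\mathcal{I}(Y,M)$; (3) if $f\colon X\to Y$ is minimal right almost split with $1_Y\notin\mathcal{I}(Y,Y)$ and $g\in\mathcal{I}(M,Y)$, then $g=fh$ for some $h\in\mathcal{I}(M,X)$.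
   Formalization: The decomposition of X is taken with n ≥ 1, that is, X is nonzero; for X = 0 the equivalence can fail (vector spaces over a field k, zero ideal, 0 → k: minimal right almost split, but a section and so not irreducible). *)

theory Defs
  imports "HOL.Hull" "HOL-Algebra.Module" "HOL-Algebra.AbelCoset"
begin

section \<open>$k$-categories\<close>

text \<open>
  Each Hom-set is a module record of HOL-Algebra; since that record extends the ring record,
  it has \<open>mult\<close> and \<open>one\<close> fields, which carry no meaning here (see \<open>End\<close> below).
  Composition is indexed by the three objects, so Hom-sets need not be disjoint:
  \<open>Comp A X Y Z g f\<close> is the composite \<open>g f\<close> of \<open>f : X \<rightarrow> Y\<close> and \<open>g : Y \<rightarrow> Z\<close>.
\<close>

record ('o, 'm, 'k) kcat =
  Ob :: "'o set"
  Hom :: "'o \<Rightarrow> 'o \<Rightarrow> ('k, 'm) module"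
  Comp :: "'o \<Rightarrow> 'o \<Rightarrow> 'o \<Rightarrow> 'm \<Rightarrow> 'm \<Rightarrow> 'm"
  Idm :: "'o \<Rightarrow> 'm"

definition arrow :: "('o, 'm, 'k) kcat \<Rightarrow> 'o \<Rightarrow> 'o \<Rightarrow> 'm \<Rightarrow> bool" where
  "arrow A X Y f \<longleftrightarrow> X \<in> Ob A \<and> Y \<in> Ob A \<and> f \<in> carrier (Hom A X Y)"

definition zero_object :: "('o, 'm, 'k) kcat \<Rightarrow> 'o \<Rightarrow> bool" where
  "zero_object A Z \<longleftrightarrow> Z \<in> Ob A \<and> (\<forall>X\<in>Ob A. (\<exists>!f. arrow A X Z f) \<and> (\<exists>!f. arrow A Z X f))"

text \<open>\<open>S\<close> is the direct sum of \<open>P\<close> and \<open>Q\<close>, with injections \<open>i\<close>, \<open>j\<close> and projections \<open>p\<close>, \<open>q\<close>.\<close>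

definition biproduct ::
  "('o, 'm, 'k) kcat \<Rightarrow> 'o \<Rightarrow> 'o \<Rightarrow> 'o \<Rightarrow> 'm \<Rightarrow> 'm \<Rightarrow> 'm \<Rightarrow> 'm \<Rightarrow> bool" where
  "biproduct A S P Q i j p q \<longleftrightarrow>
     arrow A P S i \<and> arrow A Q S j \<and> arrow A S P p \<and> arrow A S Q q \<and>
     Comp A P S P p i = Idm A P \<and> Comp A Q S Q q j = Idm A Q \<and>
     Comp A Q S P p j = \<zero>\<^bsub>Hom A Q P\<^esub> \<and> Comp A P S Q q i = \<zero>\<^bsub>Hom A P Q\<^esub> \<and>
     Comp A S P S i p \<oplus>\<^bsub>Hom A S S\<^esub> Comp A S Q S j q = Idm A S"

locale k_category =
  fixes k :: "('k, 'r) ring_scheme" and A :: "('o, 'm, 'k) kcat"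
  assumes cring_k: "cring k"
    and module_Hom: "\<lbrakk>X \<in> Ob A; Y \<in> Ob A\<rbrakk> \<Longrightarrow> module k (Hom A X Y)"
    and arrow_Idm: "X \<in> Ob A \<Longrightarrow> arrow A X X (Idm A X)"
    and arrow_Comp: "\<lbrakk>arrow A X Y f; arrow A Y Z g\<rbrakk> \<Longrightarrow> arrow A X Z (Comp A X Y Z g f)"
    and Comp_Idm_right: "arrow A X Y f \<Longrightarrow> Comp A X X Y f (Idm A X) = f"
    and Comp_Idm_left: "arrow A X Y f \<Longrightarrow> Comp A X Y Y (Idm A Y) f = f"
    and Comp_assoc: "\<lbrakk>arrow A W X f; arrow A X Y g; arrow A Y Z h\<rbrakk> \<Longrightarrow>
      Comp A W X Z (Comp A X Y Z h g) f = Comp A W Y Z h (Comp A W X Y g f)"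
    and Comp_add_left: "\<lbrakk>arrow A X Y f; arrow A Y Z g; arrow A Y Z g'\<rbrakk> \<Longrightarrow>
      Comp A X Y Z (g \<oplus>\<^bsub>Hom A Y Z\<^esub> g') f = Comp A X Y Z g f \<oplus>\<^bsub>Hom A X Z\<^esub> Comp A X Y Z g' f"
    and Comp_add_right: "\<lbrakk>arrow A X Y f; arrow A X Y f'; arrow A Y Z g\<rbrakk> \<Longrightarrow>
      Comp A X Y Z g (f \<oplus>\<^bsub>Hom A X Y\<^esub> f') = Comp A X Y Z g f \<oplus>\<^bsub>Hom A X Z\<^esub> Comp A X Y Z g f'"
    and Comp_smult_left: "\<lbrakk>c \<in> carrier k; arrow A X Y f; arrow A Y Z g\<rbrakk> \<Longrightarrow>
      Comp A X Y Z (c \<odot>\<^bsub>Hom A Y Z\<^esub> g) f = c \<odot>\<^bsub>Hom A X Z\<^esub> Comp A X Y Z g f"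
    and Comp_smult_right: "\<lbrakk>c \<in> carrier k; arrow A X Y f; arrow A Y Z g\<rbrakk> \<Longrightarrow>
      Comp A X Y Z g (c \<odot>\<^bsub>Hom A X Y\<^esub> f) = c \<odot>\<^bsub>Hom A X Z\<^esub> Comp A X Y Z g f"
    and ex_zero_object: "\<exists>Z. zero_object A Z"
    and ex_biproduct: "\<lbrakk>P \<in> Ob A; Q \<in> Ob A\<rbrakk> \<Longrightarrow> \<exists>S i j p q. biproduct A S P Q i j p q"


section \<open>Direct sums and Krull-Schmidt categories\<close>

text \<open>For \<open>n = 0\<close> the condition says that \<open>S\<close> is a zero object.\<close>

definition direct_sum :: "('o, 'm, 'k) kcat \<Rightarrow> 'o \<Rightarrow> nat \<Rightarrow> (nat \<Rightarrow> 'o) \<Rightarrow> bool" where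
  "direct_sum A S n Xs \<longleftrightarrow> S \<in> Ob A \<and> (\<exists>i p.
     (\<forall>a\<in>{1..n}. arrow A (Xs a) S (i a) \<and> arrow A S (Xs a) (p a)) \<and>
     (\<forall>a\<in>{1..n}. \<forall>b\<in>{1..n}. Comp A (Xs b) S (Xs a) (p a) (i b) =
        (if a = b then Idm A (Xs a) else \<zero>\<^bsub>Hom A (Xs b) (Xs a)\<^esub>)) \<and>
     (\<Oplus>\<^bsub>Hom A S S\<^esub> a\<in>{1..n}. Comp A S (Xs a) S (i a) (p a)) = Idm A S)"

text \<open>The morphism \<open>(f g) : P \<oplus> Q \<rightarrow> Y\<close>, where \<open>p\<close>, \<open>q\<close> are the projections of \<open>S = P \<oplus> Q\<close>.\<close>

definition row ::
  "('o, 'm, 'k) kcat \<Rightarrow> 'o \<Rightarrow> 'o \<Rightarrow> 'o \<Rightarrow> 'm \<Rightarrow> 'm \<Rightarrow> 'o \<Rightarrow> 'm \<Rightarrow> 'm \<Rightarrow> 'm" where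
  "row A S P Q p q Y f g = Comp A S P Y f p \<oplus>\<^bsub>Hom A S Y\<^esub> Comp A S Q Y g q"

definition indecomposable :: "('o, 'm, 'k) kcat \<Rightarrow> 'o \<Rightarrow> bool" where
  "indecomposable A X \<longleftrightarrow> X \<in> Ob A \<and> \<not> zero_object A X \<and>
     (\<forall>P Q i j p q. biproduct A X P Q i j p q \<longrightarrow> zero_object A P \<or> zero_object A Q)"

definition End :: "('o, 'm, 'k) kcat \<Rightarrow> 'o \<Rightarrow> ('k, 'm) module" where
  "End A X = (Hom A X X)\<lparr>mult := Comp A X X X, one := Idm A X\<rparr>"

text \<open>A not necessarily commutative ring is local if it is nonzero and its non-units are closed
  under addition.\<close>

definition local_ring :: "('a, 'b) ring_scheme \<Rightarrow> bool" where
  "local_ring R \<longleftrightarrow> ring R \<and> \<one>\<^bsub>R\<^esub> \<noteq> \<zero>\<^bsub>R\<^esub> \<and>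
     (\<forall>a \<in> carrier R - Units R. \<forall>b \<in> carrier R - Units R. a \<oplus>\<^bsub>R\<^esub> b \<notin> Units R)"

definition krull_schmidt :: "('o, 'm, 'k) kcat \<Rightarrow> bool" where
  "krull_schmidt A \<longleftrightarrow>
     (\<forall>X\<in>Ob A. \<exists>n Xs. direct_sum A X n Xs \<and> (\<forall>a\<in>{1..n}. local_ring (End A (Xs a))))"


section \<open>Almost split and irreducible morphisms\<close>

definition is_section :: "('o, 'm, 'k) kcat \<Rightarrow> 'o \<Rightarrow> 'o \<Rightarrow> 'm \<Rightarrow> bool" where
  "is_section A X Y f \<longleftrightarrow> arrow A X Y f \<and> (\<exists>r. arrow A Y X r \<and> Comp A X Y X r f = Idm A X)"

definition is_retraction :: "('o, 'm, 'k) kcat \<Rightarrow> 'o \<Rightarrow> 'o \<Rightarrow> 'm \<Rightarrow> bool" where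
  "is_retraction A X Y f \<longleftrightarrow> arrow A X Y f \<and> (\<exists>s. arrow A Y X s \<and> Comp A Y X Y f s = Idm A Y)"

definition is_iso :: "('o, 'm, 'k) kcat \<Rightarrow> 'o \<Rightarrow> 'o \<Rightarrow> 'm \<Rightarrow> bool" where
  "is_iso A X Y f \<longleftrightarrow> arrow A X Y f \<and>
     (\<exists>g. arrow A Y X g \<and> Comp A X Y X g f = Idm A X \<and> Comp A Y X Y f g = Idm A Y)"

definition is_mono :: "('o, 'm, 'k) kcat \<Rightarrow> 'o \<Rightarrow> 'o \<Rightarrow> 'm \<Rightarrow> bool" where
  "is_mono A X Y f \<longleftrightarrow> arrow A X Y f \<and>
     (\<forall>W u v. arrow A W X u \<longrightarrow> arrow A W X v \<longrightarrow>
        Comp A W X Y f u = Comp A W X Y f v \<longrightarrow> u = v)"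

definition right_almost_split :: "('o, 'm, 'k) kcat \<Rightarrow> 'o \<Rightarrow> 'o \<Rightarrow> 'm \<Rightarrow> bool" where
  "right_almost_split A X Y f \<longleftrightarrow> arrow A X Y f \<and> \<not> is_retraction A X Y f \<and>
     (\<forall>U u. arrow A U Y u \<longrightarrow> \<not> is_retraction A U Y u \<longrightarrow>
        (\<exists>v. arrow A U X v \<and> u = Comp A U X Y f v))"

definition right_minimal :: "('o, 'm, 'k) kcat \<Rightarrow> 'o \<Rightarrow> 'o \<Rightarrow> 'm \<Rightarrow> bool" where
  "right_minimal A X Y f \<longleftrightarrow> arrow A X Y f \<and>
     (\<forall>g. arrow A X X g \<longrightarrow> Comp A X X Y f g = f \<longrightarrow> is_iso A X X g)"

definition minimal_right_almost_split :: "('o, 'm, 'k) kcat \<Rightarrow> 'o \<Rightarrow> 'o \<Rightarrow> 'm \<Rightarrow> bool" where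
  "minimal_right_almost_split A X Y f \<longleftrightarrow> right_almost_split A X Y f \<and> right_minimal A X Y f"

definition left_almost_split :: "('o, 'm, 'k) kcat \<Rightarrow> 'o \<Rightarrow> 'o \<Rightarrow> 'm \<Rightarrow> bool" where
  "left_almost_split A X Y f \<longleftrightarrow> arrow A X Y f \<and> \<not> is_section A X Y f \<and>
     (\<forall>U u. arrow A X U u \<longrightarrow> \<not> is_section A X U u \<longrightarrow>
        (\<exists>v. arrow A Y U v \<and> u = Comp A X Y U v f))"

definition left_minimal :: "('o, 'm, 'k) kcat \<Rightarrow> 'o \<Rightarrow> 'o \<Rightarrow> 'm \<Rightarrow> bool" where
  "left_minimal A X Y f \<longleftrightarrow> arrow A X Y f \<and>
     (\<forall>g. arrow A Y Y g \<longrightarrow> Comp A X Y Y g f = f \<longrightarrow> is_iso A Y Y g)"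

definition minimal_left_almost_split :: "('o, 'm, 'k) kcat \<Rightarrow> 'o \<Rightarrow> 'o \<Rightarrow> 'm \<Rightarrow> bool" where
  "minimal_left_almost_split A X Y f \<longleftrightarrow> left_almost_split A X Y f \<and> left_minimal A X Y f"

definition irreducible_arrow :: "('o, 'm, 'k) kcat \<Rightarrow> 'o \<Rightarrow> 'o \<Rightarrow> 'm \<Rightarrow> bool" where
  "irreducible_arrow A X Y f \<longleftrightarrow> arrow A X Y f \<and> \<not> is_section A X Y f \<and> \<not> is_retraction A X Y f \<and>
     (\<forall>M g h. arrow A X M g \<longrightarrow> arrow A M Y h \<longrightarrow> f = Comp A X M Y h g \<longrightarrow>
        is_retraction A M Y h \<or> is_section A X M g)"


section \<open>Left Auslander-Reiten categories\<close>

definition weak_kernel :: "('o, 'm, 'k) kcat \<Rightarrow> 'o \<Rightarrow> 'o \<Rightarrow> 'o \<Rightarrow> 'm \<Rightarrow> 'm \<Rightarrow> bool" where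
  "weak_kernel A W X Y w f \<longleftrightarrow> arrow A W X w \<and> arrow A X Y f \<and>
     Comp A W X Y f w = \<zero>\<^bsub>Hom A W Y\<^esub> \<and>
     (\<forall>V g. arrow A V X g \<longrightarrow> Comp A V X Y f g = \<zero>\<^bsub>Hom A V Y\<^esub> \<longrightarrow>
        (\<exists>u. arrow A V W u \<and> g = Comp A V W X w u))"

definition weak_cokernel :: "('o, 'm, 'k) kcat \<Rightarrow> 'o \<Rightarrow> 'o \<Rightarrow> 'o \<Rightarrow> 'm \<Rightarrow> 'm \<Rightarrow> bool" where
  "weak_cokernel A X Y W f w \<longleftrightarrow> arrow A X Y f \<and> arrow A Y W w \<and>
     Comp A X Y W w f = \<zero>\<^bsub>Hom A X W\<^esub> \<and>
     (\<forall>V g. arrow A Y V g \<longrightarrow> Comp A X Y V g f = \<zero>\<^bsub>Hom A X V\<^esub> \<longrightarrow>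
        (\<exists>u. arrow A W V u \<and> g = Comp A Y W V u w))"

definition AR_sequence :: "('o, 'm, 'k) kcat \<Rightarrow> 'o \<Rightarrow> 'o \<Rightarrow> 'o \<Rightarrow> 'm \<Rightarrow> 'm \<Rightarrow> bool" where
  "AR_sequence A X Y Z f g \<longleftrightarrow> weak_kernel A X Y Z f g \<and> weak_cokernel A X Y Z f g \<and>
     minimal_left_almost_split A X Y f \<and> minimal_right_almost_split A Y Z g"

definition pseudo_projective :: "('o, 'm, 'k) kcat \<Rightarrow> 'o \<Rightarrow> bool" where
  "pseudo_projective A Z \<longleftrightarrow> (\<exists>W f. minimal_right_almost_split A W Z f \<and> is_mono A W Z f)"

definition left_AR_category ::
  "('k, 'r) ring_scheme \<Rightarrow> ('o, 'm, 'k) kcat \<Rightarrow> bool" where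
  "left_AR_category k A \<longleftrightarrow> k_category k A \<and> krull_schmidt A \<and>
     (\<forall>Z. indecomposable A Z \<longrightarrow>
        pseudo_projective A Z \<or> (\<exists>X Y f g. AR_sequence A X Y Z f g))"


section \<open>Ideals, the radical and quotient categories\<close>

definition cat_ideal ::
  "('k, 'r) ring_scheme \<Rightarrow> ('o, 'm, 'k) kcat \<Rightarrow> ('o \<Rightarrow> 'o \<Rightarrow> 'm set) \<Rightarrow> bool" where
  "cat_ideal k A I \<longleftrightarrow>
     (\<forall>X\<in>Ob A. \<forall>Y\<in>Ob A. submodule (I X Y) k (Hom A X Y)) \<and>
     (\<forall>X\<in>Ob A. \<forall>Y\<in>Ob A. \<forall>Z f g. f \<in> I X Y \<longrightarrow> arrow A Y Z g \<longrightarrow> Comp A X Y Z g f \<in> I X Z) \<and>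
     (\<forall>Y\<in>Ob A. \<forall>Z\<in>Ob A. \<forall>X f g. arrow A X Y f \<longrightarrow> g \<in> I Y Z \<longrightarrow> Comp A X Y Z g f \<in> I X Z)"

definition rad :: "('o, 'm, 'k) kcat \<Rightarrow> 'o \<Rightarrow> 'o \<Rightarrow> 'm set" where
  "rad A X Y = {f. arrow A X Y f \<and>
     (\<forall>g. arrow A Y X g \<longrightarrow> is_iso A X X (Idm A X \<ominus>\<^bsub>Hom A X X\<^esub> Comp A X Y X g f))}"

definition rad2 ::
  "('k, 'r) ring_scheme \<Rightarrow> ('o, 'm, 'k) kcat \<Rightarrow> 'o \<Rightarrow> 'o \<Rightarrow> 'm set" where
  "rad2 k A X Y = (\<lambda>H. submodule H k (Hom A X Y)) hull
     {Comp A X Z Y g f |Z g f. Z \<in> Ob A \<and> f \<in> rad A X Z \<and> g \<in> rad A Z Y}"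

definition admissible_ideal ::
  "('k, 'r) ring_scheme \<Rightarrow> ('o, 'm, 'k) kcat \<Rightarrow> ('o \<Rightarrow> 'o \<Rightarrow> 'm set) \<Rightarrow> bool" where
  "admissible_ideal k A I \<longleftrightarrow> cat_ideal k A I \<and>
     (\<forall>X Y. indecomposable A X \<longrightarrow> indecomposable A Y \<longrightarrow>
        Idm A X \<notin> I X X \<longrightarrow> Idm A Y \<notin> I Y Y \<longrightarrow> I X Y \<subseteq> rad2 k A X Y) \<and>
     (\<forall>X Y f M g. minimal_left_almost_split A X Y f \<longrightarrow> Idm A X \<notin> I X X \<longrightarrow>
        M \<in> Ob A \<longrightarrow> g \<in> I X M \<longrightarrow> (\<exists>h \<in> I Y M. g = Comp A X Y M h f)) \<and>
     (\<forall>X Y f M g. minimal_right_almost_split A X Y f \<longrightarrow> Idm A Y \<notin> I Y Y \<longrightarrow>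
        M \<in> Ob A \<longrightarrow> g \<in> I M Y \<longrightarrow> (\<exists>h \<in> I M X. g = Comp A M X Y f h))"

text \<open>The residue class \<open>f + I(X, Y)\<close>.\<close>

definition residue ::
  "('o, 'm, 'k) kcat \<Rightarrow> ('o \<Rightarrow> 'o \<Rightarrow> 'm set) \<Rightarrow> 'o \<Rightarrow> 'o \<Rightarrow> 'm \<Rightarrow> 'm set" where
  "residue A I X Y f = I X Y +>\<^bsub>Hom A X Y\<^esub> f"

text \<open>
  Operations on residue classes are given, as in \<^theory>\<open>HOL-Algebra.AbelCoset\<close>, by uniting the
  residue classes of the results over all representatives.
\<close>

definition quotient_category ::
  "('o, 'm, 'k) kcat \<Rightarrow> ('o \<Rightarrow> 'o \<Rightarrow> 'm set) \<Rightarrow> ('o, 'm set, 'k) kcat" where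
  "quotient_category A I =
     \<lparr>Ob = Ob A,
      Hom = (\<lambda>X Y. \<lparr>carrier = a_rcosets\<^bsub>Hom A X Y\<^esub> (I X Y),
                    mult = undefined, one = undefined,
                    zero = I X Y,
                    add = (<+>\<^bsub>Hom A X Y\<^esub>),
                    smult = (\<lambda>c F. \<Union>f\<in>F. residue A I X Y (c \<odot>\<^bsub>Hom A X Y\<^esub> f))\<rparr>),
      Comp = (\<lambda>X Y Z G F. \<Union>g\<in>G. \<Union>f\<in>F. residue A I X Z (Comp A X Y Z g f)),
      Idm = (\<lambda>X. residue A I X X (Idm A X))\<rparr>"

end

theory Submission
  imports Defs
begin

text \<open>
  Write \<open>\<I>\<close> for the ideal and \<open>\<A>/\<I>\<close> for the quotient category. Two facts let statements pass
  between \<open>\<A>\<close> and \<open>\<A>/\<I>\<close>. Indecomposable objects have local endomorphism rings, so an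
  indecomposable \<open>Z\<close> with \<open>1\<^sub>Z \<notin> \<I>(Z, Z)\<close> has \<open>1 - r\<close> invertible for all \<open>r \<in> \<I>(Z, Z)\<close>, and this
  property extends to finite direct sums of such objects, in particular to \<open>X\<close> and \<open>Y\<close>
  (\<open>direct_sum_ideal_in_radical\<close>). Hence a morphism into \<open>Y\<close> that becomes a retraction in \<open>\<A>/\<I>\<close> is a
  retraction, and a morphism out of \<open>X\<close> that becomes a section is a section. Secondly, by
  admissibility and \<open>1\<^sub>Y \<notin> \<I>(Y, Y)\<close>, a morphism of \<open>\<I>(M, Y)\<close> factors through every minimal right almost split
  \<open>e : E \<rightarrow> Y\<close> by a morphism of \<open>\<I>(M, E)\<close>. So an equation \<open>e \<phi> \<equiv> e\<close> modulo \<open>\<I>\<close> can be corrected to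
  an equation \<open>e \<phi>' = e\<close> with \<open>\<phi>' \<equiv> \<phi>\<close>, and right minimality makes \<open>\<phi>'\<close> an isomorphism.

  If \<open>f\<close> is irreducible and right almost split in \<open>\<A>/\<I>\<close>, then \<open>Y\<close> is indecomposable
  (\<open>almost_split_target_indecomposable\<close>), and the left Auslander-Reiten property supplies a minimal
  right almost split \<open>e : E \<rightarrow> Y\<close>. Factor \<open>f = e a\<close>. By irreducibility \<open>a\<close> is a section in \<open>\<A>/\<I>\<close>,
  hence in \<open>\<A>\<close>, and the exchange property of Krull-Schmidt categories gives \<open>E = X \<oplus> W\<close> and
  \<open>e = (f g)\<close> (\<open>section_complement\<close>). Modulo \<open>\<I>\<close>, \<open>g\<close> factors through \<open>f\<close>, so the summand \<open>W\<close> is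
  superfluous there; the correction argument turns this into \<open>1\<^sub>W \<in> \<I>(W, W)\<close>
  (\<open>minimal_right_almost_split_extension\<close>).

  Conversely, if \<open>(f g)\<close> is minimal right almost split and \<open>X'\<close> vanishes in \<open>\<A>/\<I>\<close>, then \<open>f\<close> inherits
  the factorization property there, and the correction argument shows that \<open>f \<phi> \<equiv> f\<close> forces \<open>\<phi>\<close> to be
  invertible modulo \<open>\<I>\<close>; together these yield irreducibility
  (\<open>irreducible_and_almost_split_quotient\<close>).

  Differences such as \<open>1 - r\<close> are expressed throughout by a morphism \<open>t\<close> with \<open>r + t = 1\<close>, which keeps
  every equation inside composition and addition.
\<close>

section \<open>Arithmetic of morphisms\<close>

context k_category
begin

lemma arrow_Ob: "arrow A X Y f \<Longrightarrow> X \<in> Ob A" "arrow A X Y f \<Longrightarrow> Y \<in> Ob A"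
  by (auto simp: arrow_def)

lemma abelian_group_Hom: "X \<in> Ob A \<Longrightarrow> Y \<in> Ob A \<Longrightarrow> abelian_group (Hom A X Y)"
  using module_Hom module.axioms(2) by blast

lemma abelian_monoid_Hom: "X \<in> Ob A \<Longrightarrow> Y \<in> Ob A \<Longrightarrow> abelian_monoid (Hom A X Y)"
  using abelian_group_Hom abelian_group.axioms(1) by blast

lemma arrow_zero: "X \<in> Ob A \<Longrightarrow> Y \<in> Ob A \<Longrightarrow> arrow A X Y \<zero>\<^bsub>Hom A X Y\<^esub>"
  using abelian_monoid.zero_closed[OF abelian_monoid_Hom] by (auto simp: arrow_def)

lemma arrow_add:
  "arrow A X Y f \<Longrightarrow> arrow A X Y g \<Longrightarrow> arrow A X Y (f \<oplus>\<^bsub>Hom A X Y\<^esub> g)"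
  using abelian_monoid.a_closed[OF abelian_monoid_Hom] by (auto simp: arrow_def)

lemma add_zero_left: "arrow A X Y f \<Longrightarrow> \<zero>\<^bsub>Hom A X Y\<^esub> \<oplus>\<^bsub>Hom A X Y\<^esub> f = f"
  using abelian_monoid.l_zero[OF abelian_monoid_Hom] by (auto simp: arrow_def)

lemma add_zero_right: "arrow A X Y f \<Longrightarrow> f \<oplus>\<^bsub>Hom A X Y\<^esub> \<zero>\<^bsub>Hom A X Y\<^esub> = f"
  using abelian_monoid.r_zero[OF abelian_monoid_Hom] by (auto simp: arrow_def)

lemma add_assoc:
  "arrow A X Y f \<Longrightarrow> arrow A X Y g \<Longrightarrow> arrow A X Y h \<Longrightarrow>
    (f \<oplus>\<^bsub>Hom A X Y\<^esub> g) \<oplus>\<^bsub>Hom A X Y\<^esub> h = f \<oplus>\<^bsub>Hom A X Y\<^esub> (g \<oplus>\<^bsub>Hom A X Y\<^esub> h)"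
  using abelian_monoid.a_assoc[OF abelian_monoid_Hom] by (auto simp: arrow_def)

lemma add_commute:
  "arrow A X Y f \<Longrightarrow> arrow A X Y g \<Longrightarrow> f \<oplus>\<^bsub>Hom A X Y\<^esub> g = g \<oplus>\<^bsub>Hom A X Y\<^esub> f"
  using abelian_monoid.a_comm[OF abelian_monoid_Hom] by (auto simp: arrow_def)

lemma add_left_commute:
  "arrow A X Y f \<Longrightarrow> arrow A X Y g \<Longrightarrow> arrow A X Y h \<Longrightarrow>
    f \<oplus>\<^bsub>Hom A X Y\<^esub> (g \<oplus>\<^bsub>Hom A X Y\<^esub> h) = g \<oplus>\<^bsub>Hom A X Y\<^esub> (f \<oplus>\<^bsub>Hom A X Y\<^esub> h)"
  using abelian_monoid.a_lcomm[OF abelian_monoid_Hom] by (auto simp: arrow_def)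

lemma add_left_cancel:
  assumes "arrow A X Y f" "arrow A X Y g" "arrow A X Y h"
  shows "f \<oplus>\<^bsub>Hom A X Y\<^esub> g = f \<oplus>\<^bsub>Hom A X Y\<^esub> h \<longleftrightarrow> g = h"
proof -
  interpret abelian_group "Hom A X Y"
    using abelian_group_Hom arrow_Ob assms by blast
  show ?thesis using assms r_neg1 unfolding arrow_def by metis
qed

lemma add_self_cancel:
  assumes "f = f \<oplus>\<^bsub>Hom A X Y\<^esub> g" "arrow A X Y f" "arrow A X Y g"
  shows "g = \<zero>\<^bsub>Hom A X Y\<^esub>"
  using add_left_cancel[OF assms(2) arrow_zero assms(3)] add_zero_right[OF assms(2)]
    arrow_Ob[OF assms(2)] assms(1) by auto

lemma ex_difference:
  assumes "arrow A X Y f" "arrow A X Y h"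
  shows "\<exists>g. arrow A X Y g \<and> f \<oplus>\<^bsub>Hom A X Y\<^esub> g = h"
proof -
  interpret abelian_group "Hom A X Y"
    using abelian_group_Hom arrow_Ob assms by blast
  have "f \<oplus>\<^bsub>Hom A X Y\<^esub> (\<ominus>\<^bsub>Hom A X Y\<^esub> f \<oplus>\<^bsub>Hom A X Y\<^esub> h) = h"
    using assms r_neg2 by (simp add: arrow_def)
  then show ?thesis using assms
    by (intro exI[of _ "\<ominus>\<^bsub>Hom A X Y\<^esub> f \<oplus>\<^bsub>Hom A X Y\<^esub> h"]) (simp add: arrow_def)
qed

lemma Comp_zero_left:
  assumes "arrow A X Y f" "Z \<in> Ob A"
  shows "Comp A X Y Z \<zero>\<^bsub>Hom A Y Z\<^esub> f = \<zero>\<^bsub>Hom A X Z\<^esub>"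
proof -
  note ob = arrow_Ob[OF assms(1)]
  note ar = arrow_zero[OF ob(2) assms(2)]
  have "Comp A X Y Z \<zero>\<^bsub>Hom A Y Z\<^esub> f
      = Comp A X Y Z \<zero>\<^bsub>Hom A Y Z\<^esub> f \<oplus>\<^bsub>Hom A X Z\<^esub> Comp A X Y Z \<zero>\<^bsub>Hom A Y Z\<^esub> f"
    using Comp_add_left[OF assms(1) ar ar] add_zero_left[OF ar] by simp
  then show ?thesis
    using add_self_cancel arrow_Comp[OF assms(1) ar] by blast
qed

lemma Comp_zero_right:
  assumes "arrow A Y Z g" "X \<in> Ob A"
  shows "Comp A X Y Z g \<zero>\<^bsub>Hom A X Y\<^esub> = \<zero>\<^bsub>Hom A X Z\<^esub>"
proof -
  note ob = arrow_Ob[OF assms(1)]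
  note ar = arrow_zero[OF assms(2) ob(1)]
  have "Comp A X Y Z g \<zero>\<^bsub>Hom A X Y\<^esub>
      = Comp A X Y Z g \<zero>\<^bsub>Hom A X Y\<^esub> \<oplus>\<^bsub>Hom A X Z\<^esub> Comp A X Y Z g \<zero>\<^bsub>Hom A X Y\<^esub>"
    using Comp_add_right[OF ar ar assms(1)] add_zero_left[OF ar] by simp
  then show ?thesis
    using add_self_cancel arrow_Comp[OF ar assms(1)] by blast
qed

lemmas arrow_rules = arrow_Idm arrow_Comp arrow_zero arrow_add
lemmas Comp_rules = arrow_rules Comp_Idm_left Comp_Idm_right Comp_add_left Comp_add_right
  Comp_zero_left Comp_zero_right Comp_assoc add_zero_left add_zero_right
lemmas add_ac = add_assoc add_commute add_left_commute

text \<open>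
  Composites are normalised to the right, so a known value of \<open>g f\<close> has to be applied
  inside \<open>g (f x)\<close>.
\<close>

lemma Comp_reassoc:
  assumes "Comp A X Y Z g f = h" "arrow A X Y f" "arrow A Y Z g" "arrow A W X x"
  shows "Comp A W Y Z g (Comp A W X Y f x) = Comp A W X Z h x"
  using Comp_assoc[OF assms(4,2,3)] assms(1) by simp

lemma finsum_arrow:
  assumes "X \<in> Ob A" "Y \<in> Ob A" "\<And>a. a \<in> F \<Longrightarrow> arrow A X Y (f a)"
  shows "arrow A X Y (\<Oplus>\<^bsub>Hom A X Y\<^esub> a\<in>F. f a)"
  using abelian_monoid.finsum_closed[OF abelian_monoid_Hom[OF assms(1,2)], of f F] assms
  by (auto simp: arrow_def)

lemma finsum_arrow_insert:
  assumes "X \<in> Ob A" "Y \<in> Ob A" "finite F" "b \<notin> F" "\<And>a. a \<in> insert b F \<Longrightarrow> arrow A X Y (f a)"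
  shows "(\<Oplus>\<^bsub>Hom A X Y\<^esub> a\<in>insert b F. f a) = f b \<oplus>\<^bsub>Hom A X Y\<^esub> (\<Oplus>\<^bsub>Hom A X Y\<^esub> a\<in>F. f a)"
  using abelian_monoid.finsum_insert[OF abelian_monoid_Hom[OF assms(1,2)] assms(3,4), of f] assms(5)
  by (auto simp: arrow_def)

lemma finsum_arrow_empty:
  "X \<in> Ob A \<Longrightarrow> Y \<in> Ob A \<Longrightarrow> (\<Oplus>\<^bsub>Hom A X Y\<^esub> a\<in>{}. f a) = \<zero>\<^bsub>Hom A X Y\<^esub>"
  using abelian_monoid.finsum_empty[OF abelian_monoid_Hom] by blast


section \<open>Isomorphisms, zero objects and biproducts\<close>

lemma is_isoD:
  assumes "is_iso A X Y f"
  obtains g where "arrow A X Y f" "arrow A Y X g" "Comp A X Y X g f = Idm A X"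
    "Comp A Y X Y f g = Idm A Y"
  using assms by (auto simp: is_iso_def)

lemma is_iso_Comp:
  assumes "is_iso A X Y f" "is_iso A Y Z g"
  shows "is_iso A X Z (Comp A X Y Z g f)"
proof -
  obtain f' where f: "arrow A X Y f" "arrow A Y X f'" "Comp A X Y X f' f = Idm A X"
    "Comp A Y X Y f f' = Idm A Y" using is_isoD[OF assms(1)] .
  obtain g' where g: "arrow A Y Z g" "arrow A Z Y g'" "Comp A Y Z Y g' g = Idm A Y"
    "Comp A Z Y Z g g' = Idm A Z" using is_isoD[OF assms(2)] .
  show ?thesis
    unfolding is_iso_def using f g
    by (intro conjI exI[of _ "Comp A Z Y X f' g'"])
      (simp_all add: Comp_rules Comp_reassoc[OF g(3)] Comp_reassoc[OF f(4)])
qed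

text \<open>
  In ring terms: if \<open>1 - y x\<close> has the inverse \<open>s'\<close>, then \<open>1 - x y\<close> has the inverse
  \<open>1 + x s' y\<close>.
\<close>

lemma is_iso_one_minus_swap:
  assumes x: "arrow A X Y x" and y: "arrow A Y X y" and t: "arrow A Y Y t"
    and s: "is_iso A X X s"
    and s1: "Comp A X Y X y x \<oplus>\<^bsub>Hom A X X\<^esub> s = Idm A X"
    and t1: "Comp A Y X Y x y \<oplus>\<^bsub>Hom A Y Y\<^esub> t = Idm A Y"
  shows "is_iso A Y Y t"
proof -
  obtain s' where s': "arrow A X X s" "arrow A X X s'" "Comp A X X X s' s = Idm A X"
    "Comp A X X X s s' = Idm A X" using is_isoD[OF s] .
  note ob = arrow_Ob[OF x]
  note ar = x y t s' ob
  have "Comp A X Y Y (Comp A Y X Y x y \<oplus>\<^bsub>Hom A Y Y\<^esub> t) x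
      = Comp A X X Y x (Comp A X Y X y x \<oplus>\<^bsub>Hom A X X\<^esub> s)"
    unfolding s1 t1 using ar by (simp add: Comp_rules)
  then have tx: "Comp A X Y Y t x = Comp A X X Y x s"
    using ar by (simp add: Comp_rules add_left_cancel)
  have "Comp A Y Y X y (Comp A Y X Y x y \<oplus>\<^bsub>Hom A Y Y\<^esub> t)
      = Comp A Y X X (Comp A X Y X y x \<oplus>\<^bsub>Hom A X X\<^esub> s) y"
    unfolding s1 t1 using ar by (simp add: Comp_rules)
  then have yt: "Comp A Y Y X y t = Comp A Y X X s y"
    using ar by (simp add: Comp_rules add_left_cancel)
  let ?t' = "Idm A Y \<oplus>\<^bsub>Hom A Y Y\<^esub> Comp A Y X Y x (Comp A Y X X s' y)"
  have "Comp A Y Y Y ?t' t = Idm A Y" "Comp A Y Y Y t ?t' = Idm A Y"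
    using ar yt t1
    by (simp_all add: Comp_rules Comp_reassoc[OF tx] Comp_reassoc[OF s'(3)] Comp_reassoc[OF s'(4)]
        add_commute[of Y Y t])
  then show ?thesis
    unfolding is_iso_def using ar by (intro conjI exI[of _ ?t']) (simp_all add: arrow_rules)
qed

lemma arrow_eq_zero:
  assumes "Idm A X = \<zero>\<^bsub>Hom A X X\<^esub>"
  shows "arrow A X Y f \<Longrightarrow> f = \<zero>\<^bsub>Hom A X Y\<^esub>" "arrow A Y X g \<Longrightarrow> g = \<zero>\<^bsub>Hom A Y X\<^esub>"
  using Comp_Idm_right[of X Y f] Comp_zero_right[of X Y f X] Comp_Idm_left[of Y X g]
    Comp_zero_left[of Y X g X] assms by (auto dest: arrow_Ob)

lemma zero_object_iff: "zero_object A Z \<longleftrightarrow> Z \<in> Ob A \<and> Idm A Z = \<zero>\<^bsub>Hom A Z Z\<^esub>"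
proof
  assume "zero_object A Z"
  then show "Z \<in> Ob A \<and> Idm A Z = \<zero>\<^bsub>Hom A Z Z\<^esub>"
    unfolding zero_object_def using arrow_Idm[of Z] arrow_zero[of Z Z] by blast
next
  assume Z: "Z \<in> Ob A \<and> Idm A Z = \<zero>\<^bsub>Hom A Z Z\<^esub>"
  then show "zero_object A Z"
    unfolding zero_object_def using arrow_eq_zero[of Z] arrow_zero by metis
qed

text \<open>The vanishing of the two cross terms follows from the other equations.\<close>

lemma biproductI:
  assumes i: "arrow A P S i" and j: "arrow A Q S j" and p: "arrow A S P p" and q: "arrow A S Q q"
    and pi: "Comp A P S P p i = Idm A P" and qj: "Comp A Q S Q q j = Idm A Q"
    and sum: "Comp A S P S i p \<oplus>\<^bsub>Hom A S S\<^esub> Comp A S Q S j q = Idm A S"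
  shows "biproduct A S P Q i j p q"
proof -
  note ar = i j p q arrow_Ob[OF i] arrow_Ob[OF j]
  have "Comp A Q S P p j
      = Comp A Q S P p (Comp A Q S S (Comp A S P S i p \<oplus>\<^bsub>Hom A S S\<^esub> Comp A S Q S j q) j)"
    unfolding sum using ar by (simp add: Comp_rules)
  also have "\<dots> = Comp A Q S P p j \<oplus>\<^bsub>Hom A Q P\<^esub> Comp A Q S P p j"
    using ar qj by (simp add: Comp_rules Comp_reassoc[OF pi])
  finally have "Comp A Q S P p j = \<zero>\<^bsub>Hom A Q P\<^esub>"
    by (rule add_self_cancel) (use ar in \<open>simp_all add: arrow_rules\<close>)
  moreover have "Comp A P S Q q i
      = Comp A P S Q q (Comp A P S S (Comp A S P S i p \<oplus>\<^bsub>Hom A S S\<^esub> Comp A S Q S j q) i)"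
    unfolding sum using ar by (simp add: Comp_rules)
  then have "Comp A P S Q q i = Comp A P S Q q i \<oplus>\<^bsub>Hom A P Q\<^esub> Comp A P S Q q i"
    using ar pi by (simp add: Comp_rules Comp_reassoc[OF qj])
  then have "Comp A P S Q q i = \<zero>\<^bsub>Hom A P Q\<^esub>"
    by (rule add_self_cancel) (use ar in \<open>simp_all add: arrow_rules\<close>)
  ultimately show ?thesis
    unfolding biproduct_def using assms by simp
qed

lemma biproductD:
  assumes "biproduct A S P Q i j p q"
  shows "arrow A P S i" "arrow A Q S j" "arrow A S P p" "arrow A S Q q"
    "Comp A P S P p i = Idm A P" "Comp A Q S Q q j = Idm A Q"
    "Comp A Q S P p j = \<zero>\<^bsub>Hom A Q P\<^esub>" "Comp A P S Q q i = \<zero>\<^bsub>Hom A P Q\<^esub>"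
    "P \<in> Ob A" "Q \<in> Ob A" "S \<in> Ob A"
  using assms by (auto simp: biproduct_def arrow_def)

lemma biproduct_sum:
  "biproduct A S P Q i j p q \<Longrightarrow>
    Comp A S P S i p \<oplus>\<^bsub>Hom A S S\<^esub> Comp A S Q S j q = Idm A S"
  by (simp add: biproduct_def)

lemma biproduct_iso:
  assumes S: "biproduct A S P Q i j p q"
    and t: "arrow A S T t" "arrow A T S t'" "Comp A S T S t' t = Idm A S"
      "Comp A T S T t t' = Idm A T"
  shows "biproduct A T P Q (Comp A P S T t i) (Comp A Q S T t j)
    (Comp A T S P p t') (Comp A T S Q q t')"
proof -
  note ar = biproductD[OF S] t arrow_Ob[OF t(1)]
  have "Comp A T S T (Comp A S S T t (Comp A S P S i p \<oplus>\<^bsub>Hom A S S\<^esub> Comp A S Q S j q)) t' = Idm A T"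
    unfolding biproduct_sum[OF S] using ar by (simp add: Comp_rules)
  then show ?thesis
    using ar by (intro biproductI) (simp_all add: Comp_rules Comp_reassoc[OF t(3)])
qed

lemma indecomposable_iso:
  assumes S: "indecomposable A S"
    and t: "arrow A S T t" "arrow A T S t'" "Comp A S T S t' t = Idm A S"
      "Comp A T S T t t' = Idm A T"
  shows "indecomposable A T"
  unfolding indecomposable_def
proof (intro conjI allI impI)
  show T: "T \<in> Ob A" using t arrow_Ob by blast
  show "\<not> zero_object A T"
  proof
    assume "zero_object A T"
    then have "t = \<zero>\<^bsub>Hom A S T\<^esub>"
      unfolding zero_object_iff using arrow_eq_zero(2) t by blast
    then have "Idm A S = \<zero>\<^bsub>Hom A S S\<^esub>"
      using t Comp_zero_right[OF t(2), of S] arrow_Ob by metis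
    then show False
      using S arrow_Ob[OF t(1)] by (simp add: indecomposable_def zero_object_iff)
  qed
  fix P Q i j p q assume "biproduct A T P Q i j p q"
  from biproduct_iso[OF this t(2,1,4,3)] S
  show "zero_object A P \<or> zero_object A Q" unfolding indecomposable_def by blast
qed


section \<open>Objects with local endomorphism ring\<close>

text \<open>
  Locality of the endomorphism ring in terms of isomorphisms of the category. Two endomorphisms
  with the sum \<open>1\<close> suffice, as any invertible sum can be normalised to \<open>1\<close>.
\<close>

definition local_object :: "'o \<Rightarrow> bool" where
  "local_object X \<longleftrightarrow> X \<in> Ob A \<and> Idm A X \<noteq> \<zero>\<^bsub>Hom A X X\<^esub> \<and>
     (\<forall>f g. arrow A X X f \<longrightarrow> arrow A X X g \<longrightarrow> f \<oplus>\<^bsub>Hom A X X\<^esub> g = Idm A X \<longrightarrow>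
        is_iso A X X f \<or> is_iso A X X g)"

lemma local_objectI:
  assumes X: "X \<in> Ob A" and loc: "local_ring (End A X)"
  shows "local_object X"
proof -
  have U: "f \<in> Units (End A X) \<longleftrightarrow> is_iso A X X f" for f
    using X by (auto simp: Units_def End_def is_iso_def arrow_def)
  have "Idm A X \<noteq> \<zero>\<^bsub>Hom A X X\<^esub>"
    using loc by (simp add: local_ring_def End_def)
  moreover have "is_iso A X X (Idm A X)"
    using X arrow_Idm Comp_Idm_left unfolding is_iso_def by blast
  moreover have "carrier (End A X) = carrier (Hom A X X)" "add (End A X) = add (Hom A X X)"
    by (simp_all add: End_def)
  ultimately have nz: "Idm A X \<noteq> \<zero>\<^bsub>Hom A X X\<^esub>"
    and unit: "Idm A X \<in> Units (End A X)"
    and c: "\<And>f. arrow A X X f \<Longrightarrow> f \<in> carrier (End A X)"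
    and add: "add (End A X) = add (Hom A X X)"
    using U by (simp_all add: arrow_def)
  have "f \<in> Units (End A X) \<or> g \<in> Units (End A X)"
    if fg: "arrow A X X f" "arrow A X X g" "f \<oplus>\<^bsub>Hom A X X\<^esub> g = Idm A X" for f g
  proof (rule ccontr)
    assume "\<not> ?thesis"
    then have "f \<oplus>\<^bsub>End A X\<^esub> g \<notin> Units (End A X)"
      using loc c[OF fg(1)] c[OF fg(2)] unfolding local_ring_def by blast
    then show False
      using fg(3) unit add by simp
  qed
  then show ?thesis
    using X nz unfolding local_object_def U by blast
qed

lemma local_object_iso:
  assumes S: "local_object S"
    and t: "arrow A S T t" "arrow A T S t'" "Comp A S T S t' t = Idm A S"
      "Comp A T S T t t' = Idm A T"
  shows "local_object T"
  unfolding local_object_def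
proof (intro conjI allI impI)
  note ar = t arrow_Ob[OF t(1)]
  show "T \<in> Ob A" by fact
  show "Idm A T \<noteq> \<zero>\<^bsub>Hom A T T\<^esub>"
  proof
    assume "Idm A T = \<zero>\<^bsub>Hom A T T\<^esub>"
    then have "t = \<zero>\<^bsub>Hom A S T\<^esub>"
      using arrow_eq_zero(2) t by blast
    then have "Idm A S = \<zero>\<^bsub>Hom A S S\<^esub>"
      using t Comp_zero_right[OF t(2), of S] arrow_Ob by metis
    then show False using S by (simp add: local_object_def)
  qed
  have it: "is_iso A S T t" "is_iso A T S t'"
    using t unfolding is_iso_def by blast+
  have reflect: "is_iso A T T h"
    if h: "arrow A T T h" "is_iso A S S (Comp A S T S t' (Comp A S T T h t))" for h
  proof -
    have "h = Comp A T S T t (Comp A T S S (Comp A S T S t' (Comp A S T T h t)) t')"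
      using ar h by (simp add: Comp_rules Comp_reassoc[OF t(4)])
    then show ?thesis
      using is_iso_Comp[OF is_iso_Comp[OF it(2) h(2)] it(1)] by simp
  qed
  fix f g assume fg: "arrow A T T f" "arrow A T T g" "f \<oplus>\<^bsub>Hom A T T\<^esub> g = Idm A T"
  have "Comp A S T S t' (Comp A S T T (f \<oplus>\<^bsub>Hom A T T\<^esub> g) t) = Idm A S"
    unfolding fg(3) using ar by (simp add: Comp_rules)
  then have "Comp A S T S t' (Comp A S T T f t) \<oplus>\<^bsub>Hom A S S\<^esub> Comp A S T S t' (Comp A S T T g t)
      = Idm A S"
    using ar fg(1,2) by (simp add: Comp_rules)
  then have "is_iso A S S (Comp A S T S t' (Comp A S T T f t)) \<or>
      is_iso A S S (Comp A S T S t' (Comp A S T T g t))"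
    using S ar fg unfolding local_object_def by (simp add: arrow_rules)
  then show "is_iso A T T f \<or> is_iso A T T g"
    using reflect fg by blast
qed

lemma local_object_add_iso:
  assumes X: "local_object X" and f: "arrow A X X f" and g: "arrow A X X g"
    and s: "is_iso A X X (f \<oplus>\<^bsub>Hom A X X\<^esub> g)"
  shows "is_iso A X X f \<or> is_iso A X X g"
proof -
  let ?s = "f \<oplus>\<^bsub>Hom A X X\<^esub> g"
  obtain s' where s': "arrow A X X ?s" "arrow A X X s'" "Comp A X X X s' ?s = Idm A X"
    "Comp A X X X ?s s' = Idm A X" using is_isoD[OF s] .
  have reflect: "is_iso A X X h" if "arrow A X X h" "is_iso A X X (Comp A X X X s' h)" for h
  proof -
    have "h = Comp A X X X ?s (Comp A X X X s' h)"
      using Comp_assoc[OF that(1) s'(2,1)] that(1) s' by (simp add: Comp_Idm_left)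
    then show ?thesis using is_iso_Comp[OF that(2) s] by simp
  qed
  have "Comp A X X X s' f \<oplus>\<^bsub>Hom A X X\<^esub> Comp A X X X s' g = Idm A X"
    using s'(3) f g s'(2) by (simp add: Comp_add_right)
  then have "is_iso A X X (Comp A X X X s' f) \<or> is_iso A X X (Comp A X X X s' g)"
    using X f g s'(2) unfolding local_object_def by (simp add: arrow_rules)
  then show ?thesis using reflect f g by blast
qed

lemma local_object_finsum_iso:
  assumes X: "local_object X" and "finite F" "\<And>a. a \<in> F \<Longrightarrow> arrow A X X (f a)"
    and "is_iso A X X (\<Oplus>\<^bsub>Hom A X X\<^esub> a\<in>F. f a)"
  shows "\<exists>a\<in>F. is_iso A X X (f a)"
  using assms(2-)
proof (induction F)
  case empty
  have Xo: "X \<in> Ob A" "Idm A X \<noteq> \<zero>\<^bsub>Hom A X X\<^esub>"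
    using X by (auto simp: local_object_def)
  obtain g where "arrow A X X g" "Comp A X X X \<zero>\<^bsub>Hom A X X\<^esub> g = Idm A X"
    using empty(2) unfolding finsum_arrow_empty[OF Xo(1) Xo(1)] by (auto simp: is_iso_def)
  then show ?case using Xo Comp_zero_left by simp
next
  case (insert b F)
  have Xo: "X \<in> Ob A" using X by (auto simp: local_object_def)
  have "is_iso A X X (f b) \<or> is_iso A X X (\<Oplus>\<^bsub>Hom A X X\<^esub> a\<in>F. f a)"
    using insert.prems(2) finsum_arrow_insert[OF Xo Xo insert.hyps insert.prems(1)]
    by (intro local_object_add_iso[OF X] finsum_arrow Xo insert.prems(1)) auto
  then show ?case using insert.IH insert.prems(1) by blast
qed

text \<open>The composite \<open>a b\<close> is a nonzero idempotent, and a local ring has none besides \<open>1\<close>.\<close>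

lemma section_into_local_object:
  assumes Z: "local_object Z" and X: "Idm A X \<noteq> \<zero>\<^bsub>Hom A X X\<^esub>"
    and a: "arrow A X Z a" and b: "arrow A Z X b" and ba: "Comp A X Z X b a = Idm A X"
  shows "Comp A Z X Z a b = Idm A Z"
proof -
  note ar = a b ba arrow_Ob[OF a]
  let ?e = "Comp A Z X Z a b"
  obtain d where d: "arrow A Z Z d" "?e \<oplus>\<^bsub>Hom A Z Z\<^esub> d = Idm A Z"
    using ex_difference[of Z Z ?e "Idm A Z"] ar by (auto simp: arrow_rules)
  have "Comp A X Z Z (?e \<oplus>\<^bsub>Hom A Z Z\<^esub> d) a = a"
    unfolding d(2) using ar by (simp add: Comp_rules)
  then have "a = a \<oplus>\<^bsub>Hom A X Z\<^esub> Comp A X Z Z d a"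
    using ar d(1) by (simp add: Comp_rules)
  then have da: "Comp A X Z Z d a = \<zero>\<^bsub>Hom A X Z\<^esub>"
    by (rule add_self_cancel) (use ar d in \<open>simp_all add: arrow_rules\<close>)
  have "is_iso A Z Z ?e \<or> is_iso A Z Z d"
    using Z d ar unfolding local_object_def by (simp add: arrow_rules)
  then show ?thesis
  proof
    assume "is_iso A Z Z ?e"
    then obtain w where w: "arrow A Z Z ?e" "arrow A Z Z w" "Comp A Z Z Z w ?e = Idm A Z"
      "Comp A Z Z Z ?e w = Idm A Z" using is_isoD by metis
    have "Comp A Z Z Z ?e (Comp A Z Z Z ?e w) = Comp A Z Z Z ?e w"
      using ar w(2) by (simp add: Comp_rules Comp_reassoc[OF ba])
    then show ?thesis using w(4) w(1) by (simp add: Comp_Idm_right)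
  next
    assume "is_iso A Z Z d"
    then obtain w where w: "arrow A Z Z d" "arrow A Z Z w" "Comp A Z Z Z w d = Idm A Z"
      using is_isoD by metis
    have "a = Comp A X Z Z w (Comp A X Z Z d a)"
      using ar w by (simp add: Comp_rules Comp_reassoc[OF w(3)])
    then have "a = \<zero>\<^bsub>Hom A X Z\<^esub>"
      using da Comp_zero_right[OF w(2), of X] ar by simp
    then have "Idm A X = \<zero>\<^bsub>Hom A X X\<^esub>"
      using ba Comp_zero_right[OF b, of X] ar by simp
    then show ?thesis using X by blast
  qed
qed


section \<open>Splitting idempotents\<close>

text \<open>The equations make \<open>e\<close> idempotent and \<open>W\<close> the summand of \<open>E\<close> cut out by \<open>e\<close>.\<close>

definition splits :: "'o \<Rightarrow> 'm \<Rightarrow> bool" where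
  "splits E e \<longleftrightarrow> (\<exists>W u v. arrow A W E u \<and> arrow A E W v \<and>
     Comp A W E W v u = Idm A W \<and> Comp A E W E u v = e)"

lemma splits_zero: "E \<in> Ob A \<Longrightarrow> splits E \<zero>\<^bsub>Hom A E E\<^esub>"
proof -
  assume E: "E \<in> Ob A"
  obtain Z where Z: "Z \<in> Ob A" "Idm A Z = \<zero>\<^bsub>Hom A Z Z\<^esub>"
    using ex_zero_object zero_object_iff by blast
  then show ?thesis
    unfolding splits_def using E Z Comp_zero_right[of Z E "\<zero>\<^bsub>Hom A Z E\<^esub>" E]
      Comp_zero_right[of E Z "\<zero>\<^bsub>Hom A E Z\<^esub>" Z] arrow_zero
    by (intro exI[of _ Z] exI[of _ "\<zero>\<^bsub>Hom A Z E\<^esub>"] exI[of _ "\<zero>\<^bsub>Hom A E Z\<^esub>"]) simp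
qed

text \<open>The sum of two orthogonal idempotents cuts out the biproduct of the two summands.\<close>

lemma splits_add:
  assumes e: "splits E e" and e': "splits E e'"
    and ee': "Comp A E E E e e' = \<zero>\<^bsub>Hom A E E\<^esub>"
    and e'e: "Comp A E E E e' e = \<zero>\<^bsub>Hom A E E\<^esub>"
  shows "splits E (e \<oplus>\<^bsub>Hom A E E\<^esub> e')"
proof -
  obtain W u v where W: "arrow A W E u" "arrow A E W v" "Comp A W E W v u = Idm A W"
    and eW: "Comp A E W E u v = e" using e by (auto simp: splits_def)
  obtain W' u' v' where W': "arrow A W' E u'" "arrow A E W' v'" "Comp A W' E W' v' u' = Idm A W'"
    and eW': "Comp A E W' E u' v' = e'" using e' by (auto simp: splits_def)
  note ar = W W' arrow_Ob[OF W(1)] arrow_Ob[OF W'(1)]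
  have "Comp A W' E W v u' = Comp A W' E W v (Comp A W' E E
      (Comp A E E E (Comp A E W E u v) (Comp A E W' E u' v')) u')"
    using ar by (simp add: Comp_rules Comp_reassoc[OF W(3)])
  then have vu': "Comp A W' E W v u' = \<zero>\<^bsub>Hom A W' W\<^esub>"
    unfolding eW eW' ee' using ar by (simp add: Comp_rules)
  have "Comp A W E W' v' u = Comp A W E W' v' (Comp A W E E
      (Comp A E E E (Comp A E W' E u' v') (Comp A E W E u v)) u)"
    using ar by (simp add: Comp_rules Comp_reassoc[OF W'(3)])
  then have v'u: "Comp A W E W' v' u = \<zero>\<^bsub>Hom A W W'\<^esub>"
    unfolding eW eW' e'e using ar by (simp add: Comp_rules)
  obtain S i j p q where S: "biproduct A S W W' i j p q"
    using ex_biproduct ar by blast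
  note br = ar biproductD[OF S]
  let ?u = "Comp A S W E u p \<oplus>\<^bsub>Hom A S E\<^esub> Comp A S W' E u' q"
  let ?v = "Comp A E W S i v \<oplus>\<^bsub>Hom A E S\<^esub> Comp A E W' S j v'"
  have "Comp A S E S ?v ?u = Idm A S"
    unfolding biproduct_sum[OF S, symmetric] using br
    by (simp add: Comp_rules Comp_reassoc[OF vu'] Comp_reassoc[OF v'u]
        Comp_reassoc[OF W(3)] Comp_reassoc[OF W'(3)])
  moreover have "Comp A E S E ?u ?v = e \<oplus>\<^bsub>Hom A E E\<^esub> e'"
    unfolding eW[symmetric] eW'[symmetric] using br
    by (simp add: Comp_rules Comp_reassoc[OF br(15)] Comp_reassoc[OF br(16)]
        Comp_reassoc[OF br(17)] Comp_reassoc[OF br(18)])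
  ultimately show ?thesis
    unfolding splits_def using br by (intro exI[of _ S] exI[of _ ?u] exI[of _ ?v]) (simp add: arrow_rules)
qed

end

text \<open>A direct sum together with a choice of its injections \<open>i\<close> and projections \<open>p\<close>.\<close>

locale decomposition = k_category k A
  for k :: "('k, 'r) ring_scheme" and A :: "('o, 'm, 'k) kcat" +
  fixes S :: 'o and n :: nat and Xs :: "nat \<Rightarrow> 'o" and i p :: "nat \<Rightarrow> 'm"
  assumes S: "S \<in> Ob A"
    and arrow_i: "a \<in> {1..n} \<Longrightarrow> arrow A (Xs a) S (i a)"
    and arrow_p: "a \<in> {1..n} \<Longrightarrow> arrow A S (Xs a) (p a)"
    and p_i: "\<lbrakk>a \<in> {1..n}; b \<in> {1..n}\<rbrakk> \<Longrightarrow> Comp A (Xs b) S (Xs a) (p a) (i b) =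
      (if a = b then Idm A (Xs a) else \<zero>\<^bsub>Hom A (Xs b) (Xs a)\<^esub>)"
    and sum_i_p: "(\<Oplus>\<^bsub>Hom A S S\<^esub> a\<in>{1..n}. Comp A S (Xs a) S (i a) (p a)) = Idm A S"

lemma (in k_category) direct_sum_decomposition:
  assumes "direct_sum A S n Xs"
  obtains i p where "decomposition k A S n Xs i p"
proof -
  obtain i p where ip: "\<forall>a\<in>{1..n}. arrow A (Xs a) S (i a) \<and> arrow A S (Xs a) (p a)"
    "\<forall>a\<in>{1..n}. \<forall>b\<in>{1..n}. Comp A (Xs b) S (Xs a) (p a) (i b) =
        (if a = b then Idm A (Xs a) else \<zero>\<^bsub>Hom A (Xs b) (Xs a)\<^esub>)"
    "(\<Oplus>\<^bsub>Hom A S S\<^esub> a\<in>{1..n}. Comp A S (Xs a) S (i a) (p a)) = Idm A S" and "S \<in> Ob A"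
    using assms unfolding direct_sum_def by blast
  then have "decomposition k A S n Xs i p"
    by (intro decomposition.intro decomposition_axioms.intro k_category_axioms) blast+
  then show ?thesis by (rule that)
qed

context decomposition
begin

lemma Xs: "a \<in> {1..n} \<Longrightarrow> Xs a \<in> Ob A"
  using arrow_i arrow_Ob by blast

definition proj_on :: "nat set \<Rightarrow> 'm" where
  "proj_on F = (\<Oplus>\<^bsub>Hom A S S\<^esub> a\<in>F. Comp A S (Xs a) S (i a) (p a))"

lemma arrow_proj_on: "F \<subseteq> {1..n} \<Longrightarrow> arrow A S S (proj_on F)"
  unfolding proj_on_def by (intro finsum_arrow S arrow_Comp[OF arrow_p arrow_i]) auto

lemma proj_on_empty: "proj_on {} = \<zero>\<^bsub>Hom A S S\<^esub>"
  unfolding proj_on_def using finsum_arrow_empty S by blast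

lemma proj_on_all: "proj_on {1..n} = Idm A S"
  unfolding proj_on_def by (rule sum_i_p)

lemma proj_on_insert:
  assumes "l \<notin> F" "insert l F \<subseteq> {1..n}"
  shows "proj_on (insert l F) = Comp A S (Xs l) S (i l) (p l) \<oplus>\<^bsub>Hom A S S\<^esub> proj_on F"
  unfolding proj_on_def
proof (rule finsum_arrow_insert[OF S S _ assms(1)])
  show "finite F" using assms(2) finite_subset[of F "{1..n}"] by simp
  show "arrow A S S (Comp A S (Xs a) S (i a) (p a))" if "a \<in> insert l F" for a
  proof -
    from that assms(2) have "a \<in> {1..n}" by auto
    then show ?thesis using arrow_Comp[OF arrow_p arrow_i] by blast
  qed
qed

lemma proj_on_orthogonal:
  assumes "F \<subseteq> {1..n}" "l \<in> {1..n}" "l \<notin> F"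
  shows "Comp A S S (Xs l) (p l) (proj_on F) = \<zero>\<^bsub>Hom A S (Xs l)\<^esub>"
    and "Comp A (Xs l) S S (proj_on F) (i l) = \<zero>\<^bsub>Hom A (Xs l) S\<^esub>"
proof -
  have "finite F" using assms(1) finite_subset by blast
  then have "Comp A S S (Xs l) (p l) (proj_on F) = \<zero>\<^bsub>Hom A S (Xs l)\<^esub> \<and>
      Comp A (Xs l) S S (proj_on F) (i l) = \<zero>\<^bsub>Hom A (Xs l) S\<^esub>"
    using assms(1,3)
  proof (induction F)
    case empty
    show ?case
      unfolding proj_on_empty using arrow_i arrow_p assms(2) S Comp_zero_left Comp_zero_right by blast
  next
    case (insert b F)
    then have b: "b \<in> {1..n}" "l \<noteq> b" by auto
    note ar = arrow_i[OF b(1)] arrow_p[OF b(1)] arrow_i[OF assms(2)] arrow_p[OF assms(2)]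
      arrow_proj_on[of F] Xs[OF b(1)] Xs[OF assms(2)] S
    have IH: "Comp A S S (Xs l) (p l) (proj_on F) = \<zero>\<^bsub>Hom A S (Xs l)\<^esub>"
        "Comp A (Xs l) S S (proj_on F) (i l) = \<zero>\<^bsub>Hom A (Xs l) S\<^esub>"
      using insert by auto
    have o: "Comp A (Xs b) S (Xs l) (p l) (i b) = \<zero>\<^bsub>Hom A (Xs b) (Xs l)\<^esub>"
      "Comp A (Xs l) S (Xs b) (p b) (i l) = \<zero>\<^bsub>Hom A (Xs l) (Xs b)\<^esub>"
      using p_i b assms(2) by auto
    show ?case
      unfolding proj_on_insert[OF insert.hyps(2) insert.prems(1)] using ar IH o insert.prems(1)
      by (simp add: Comp_rules Comp_reassoc[OF o(1)])
  qed
  then show "Comp A S S (Xs l) (p l) (proj_on F) = \<zero>\<^bsub>Hom A S (Xs l)\<^esub>"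
    and "Comp A (Xs l) S S (proj_on F) (i l) = \<zero>\<^bsub>Hom A (Xs l) S\<^esub>" by auto
qed

lemma splits_proj_on:
  assumes "F \<subseteq> {1..n}"
  shows "splits S (proj_on F)"
proof -
  have "finite F" using assms finite_subset by blast
  then show ?thesis using assms
  proof (induction F)
    case empty
    show ?case unfolding proj_on_empty by (rule splits_zero[OF S])
  next
    case (insert l F)
    then have l: "l \<in> {1..n}" and F: "F \<subseteq> {1..n}" by auto
    note ar = arrow_i[OF l] arrow_p[OF l] arrow_proj_on[OF F] Xs[OF l] S
    note o = proj_on_orthogonal[OF F l insert.hyps(2)]
    have "splits S (Comp A S (Xs l) S (i l) (p l))"
      unfolding splits_def using ar p_i[OF l l] by auto
    then show ?case
      unfolding proj_on_insert[OF insert.hyps(2) insert.prems]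
      using insert.IH[OF F] ar o
      by (intro splits_add) (simp_all add: Comp_rules Comp_reassoc[OF o(2)])
  qed
qed

lemma summand_biproduct:
  assumes l: "l \<in> {1..n}"
  obtains W u v where "biproduct A S (Xs l) W (i l) u (p l) v"
proof -
  obtain W u v where W: "arrow A W S u" "arrow A S W v" "Comp A W S W v u = Idm A W"
    "Comp A S W S u v = proj_on ({1..n} - {l})"
    using splits_proj_on[of "{1..n} - {l}"] unfolding splits_def by auto
  have "proj_on {1..n}
      = Comp A S (Xs l) S (i l) (p l) \<oplus>\<^bsub>Hom A S S\<^esub> proj_on ({1..n} - {l})"
    using proj_on_insert[of l "{1..n} - {l}"] l by (simp add: insert_absorb)
  then show ?thesis
    using that[OF biproductI[OF arrow_i[OF l] W(1) arrow_p[OF l] W(2) _ W(3)]] W(4)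
      p_i[OF l l] proj_on_all by simp
qed

end

context k_category
begin

text \<open>
  An indecomposable object has a complement to its first summand with local endomorphism ring;
  this complement vanishes, so that the object is isomorphic to the summand.
\<close>

lemma indecomposable_local:
  assumes ks: "krull_schmidt A" and X: "indecomposable A X"
  shows "local_object X"
proof -
  have Xo: "X \<in> Ob A" "Idm A X \<noteq> \<zero>\<^bsub>Hom A X X\<^esub>"
    using X zero_object_iff by (auto simp: indecomposable_def)
  obtain n Zs i p where "decomposition k A X n Zs i p"
    and Z: "\<And>a. a \<in> {1..n} \<Longrightarrow> local_ring (End A (Zs a))"
    using ks Xo direct_sum_decomposition unfolding krull_schmidt_def by metis
  interpret decomposition k A X n Zs i p by fact
  have "{1..n} \<noteq> {}"
    using proj_on_all proj_on_empty Xo(2) by metis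
  then have one: "1 \<in> {1..n}" by simp
  have loc: "local_object (Zs 1)" by (rule local_objectI[OF Xs[OF one] Z[OF one]])
  obtain W u v where B: "biproduct A X (Zs 1) W (i 1) u (p 1) v"
    using summand_biproduct[OF one] .
  note ar = biproductD[OF B]
  have "zero_object A (Zs 1) \<or> zero_object A W"
    using X B unfolding indecomposable_def by blast
  then have "zero_object A W"
    using loc unfolding local_object_def zero_object_iff by blast
  then have "u = \<zero>\<^bsub>Hom A W X\<^esub>"
    unfolding zero_object_iff using arrow_eq_zero(1) ar(2) by blast
  then have "Comp A X (Zs 1) X (i 1) (p 1) = Idm A X"
    using biproduct_sum[OF B] ar by (simp add: Comp_rules)
  then show ?thesis
    using local_object_iso[OF loc ar(1,3,5)] by simp
qed

text \<open>Here \<open>d\<close> is the complementary idempotent \<open>1 - a b\<close>.\<close>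

lemma complement_orthogonal:
  assumes a: "arrow A X E a" and b: "arrow A E X b" and d: "arrow A E E d"
    and ba: "Comp A X E X b a = Idm A X"
    and abd: "Comp A E X E a b \<oplus>\<^bsub>Hom A E E\<^esub> d = Idm A E"
  shows "Comp A X E E d a = \<zero>\<^bsub>Hom A X E\<^esub>" and "Comp A E E X b d = \<zero>\<^bsub>Hom A E X\<^esub>"
proof -
  note ar = a b d arrow_Ob[OF a]
  have "Comp A X E E (Comp A E X E a b \<oplus>\<^bsub>Hom A E E\<^esub> d) a = a"
    unfolding abd using ar by (simp add: Comp_rules)
  then have "a = a \<oplus>\<^bsub>Hom A X E\<^esub> Comp A X E E d a"
    using ar ba by (simp add: Comp_rules)
  then show "Comp A X E E d a = \<zero>\<^bsub>Hom A X E\<^esub>"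
    by (rule add_self_cancel) (use ar in \<open>simp_all add: arrow_rules\<close>)
  have "Comp A E E X b (Comp A E X E a b \<oplus>\<^bsub>Hom A E E\<^esub> d) = b"
    unfolding abd using ar by (simp add: Comp_rules)
  then have "b = b \<oplus>\<^bsub>Hom A E X\<^esub> Comp A E E X b d"
    using ar by (simp add: Comp_rules Comp_reassoc[OF ba])
  then show "Comp A E E X b d = \<zero>\<^bsub>Hom A E X\<^esub>"
    by (rule add_self_cancel) (use ar in \<open>simp_all add: arrow_rules\<close>)
qed

text \<open>
  The exchange argument: one of the summands \<open>Z\<close> of \<open>E\<close> is isomorphic to \<open>X\<close> via
  \<open>X \<rightarrow> E \<rightarrow> Z\<close>, because the identity of \<open>X\<close> is the sum of the maps \<open>X \<rightarrow> E \<rightarrow> Z \<rightarrow> E \<rightarrow> X\<close>.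
  Hence a complement of \<open>Z\<close> in \<open>E\<close> is also one of \<open>X\<close>.
\<close>

lemma local_section_complement:
  assumes ks: "krull_schmidt A" and X: "local_object X"
    and a: "arrow A X E a" and b: "arrow A E X b" and ba: "Comp A X E X b a = Idm A X"
  obtains W u v where "biproduct A E X W a u b v"
proof -
  note ar = a b arrow_Ob[OF a]
  obtain n Zs i p where "decomposition k A E n Zs i p"
    and Z: "\<And>l. l \<in> {1..n} \<Longrightarrow> local_ring (End A (Zs l))"
    using ks arrow_Ob(2)[OF a] direct_sum_decomposition unfolding krull_schmidt_def by metis
  interpret decomposition k A E n Zs i p by fact
  have X1: "Idm A X \<noteq> \<zero>\<^bsub>Hom A X X\<^esub>" using X by (simp add: local_object_def)
  let ?f = "\<lambda>l. Comp A X E X b (Comp A X (Zs l) E (i l) (Comp A X E (Zs l) (p l) a))"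
  have arf: "arrow A X X (?f l)" if "l \<in> {1..n}" for l
    using ar arrow_i arrow_p that by (simp add: arrow_rules)
  have "finite F \<Longrightarrow> F \<subseteq> {1..n} \<Longrightarrow> Comp A X E X b (Comp A X E E (proj_on F) a)
      = (\<Oplus>\<^bsub>Hom A X X\<^esub> l\<in>F. ?f l)" for F
  proof (induction F rule: finite_induct)
    case empty
    show ?case
      unfolding proj_on_empty finsum_arrow_empty[OF ar(3,3)] using ar by (simp add: Comp_rules)
  next
    case (insert l F)
    then have l: "l \<in> {1..n}" and F: "F \<subseteq> {1..n}" by auto
    have "(\<Oplus>\<^bsub>Hom A X X\<^esub> l\<in>insert l F. ?f l)
        = ?f l \<oplus>\<^bsub>Hom A X X\<^esub> (\<Oplus>\<^bsub>Hom A X X\<^esub> l\<in>F. ?f l)"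
      using insert.prems arf by (intro finsum_arrow_insert ar insert.hyps) blast
    then show ?case
      unfolding proj_on_insert[OF insert.hyps(2) insert.prems] insert.IH[OF F, symmetric]
      using ar arrow_i[OF l] arrow_p[OF l] arrow_proj_on[OF F] by (simp add: Comp_rules)
  qed
  from this[of "{1..n}"] have "(\<Oplus>\<^bsub>Hom A X X\<^esub> l\<in>{1..n}. ?f l) = Idm A X"
    unfolding proj_on_all using ar ba by (simp add: Comp_rules)
  moreover have "is_iso A X X (Idm A X)"
    unfolding is_iso_def using ar arrow_Idm Comp_Idm_left by blast
  ultimately obtain l where l: "l \<in> {1..n}" "is_iso A X X (?f l)"
    using local_object_finsum_iso[OF X, of "{1..n}" ?f] arf by auto
  obtain s where s: "arrow A X X s" "Comp A X X X s (?f l) = Idm A X"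
    using is_isoD[OF l(2)] by metis
  note ar = ar arrow_i[OF l(1)] arrow_p[OF l(1)] Xs[OF l(1)] s(1)
  \<comment> \<open>\<open>c\<close> is the isomorphism from \<open>X\<close> to the summand and \<open>c'\<close> its inverse\<close>
  define c where "c = Comp A X E (Zs l) (p l) a"
  define c' where "c' = Comp A (Zs l) X X s (Comp A (Zs l) E X b (i l))"
  have c: "arrow A X (Zs l) c" "arrow A (Zs l) X c'"
    unfolding c_def c'_def using ar by (simp_all add: arrow_rules)
  have c'c: "Comp A X (Zs l) X c' c = Idm A X"
    using s(2) ar unfolding c_def c'_def by (simp add: Comp_rules)
  have cc': "Comp A (Zs l) X (Zs l) c c' = Idm A (Zs l)"
    using section_into_local_object[OF local_objectI X1 c c'c] Z l(1) ar by blast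
  obtain W u v where B: "biproduct A E (Zs l) W (i l) u (p l) v"
    using summand_biproduct[OF l(1)] .
  note ar = ar c biproductD[OF B]
  \<comment> \<open>Two idempotents of \<open>E\<close> have the image \<open>X\<close>: \<open>a q\<close>, with the kernel \<open>W\<close>, and \<open>a b\<close>.
    The complement \<open>d = 1 - a b\<close> therefore factors through \<open>W\<close> as well, namely as
    \<open>d = (d u) (v d')\<close> with \<open>d' = 1 - a q\<close>.\<close>
  define q where "q = Comp A E (Zs l) X c' (p l)"
  have q: "arrow A E X q" "Comp A X E X q a = Idm A X"
    "Comp A W E X q u = \<zero>\<^bsub>Hom A W X\<^esub>" "p l = Comp A E X (Zs l) c q"
    using ar c'c unfolding q_def by (simp_all add: Comp_rules c_def[symmetric] Comp_reassoc[OF cc'])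
  obtain d where d: "arrow A E E d" "Comp A E X E a b \<oplus>\<^bsub>Hom A E E\<^esub> d = Idm A E"
    using ex_difference[of E E "Comp A E X E a b" "Idm A E"] ar by (auto simp: arrow_rules)
  obtain d' where d': "arrow A E E d'" "Comp A E X E a q \<oplus>\<^bsub>Hom A E E\<^esub> d' = Idm A E"
    using ex_difference[of E E "Comp A E X E a q" "Idm A E"] ar q by (auto simp: arrow_rules)
  note o = complement_orthogonal[OF a b d(1) ba d(2)]
  note o' = complement_orthogonal[OF a q(1) d'(1) q(2) d'(2)]
  have "Comp A E E E d (Comp A E X E a q \<oplus>\<^bsub>Hom A E E\<^esub> d') = d"
    unfolding d' using ar d(1) by (simp add: Comp_rules)
  then have dd': "Comp A E E E d d' = d"
    using ar d(1) d'(1) q(1) by (simp add: Comp_rules Comp_reassoc[OF o(1)])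
  have "Comp A E E E d' (Comp A E X E a b \<oplus>\<^bsub>Hom A E E\<^esub> d) = d'"
    unfolding d using ar d'(1) by (simp add: Comp_rules)
  then have d'd: "Comp A E E E d' d = d'"
    using ar d(1) d'(1) by (simp add: Comp_rules Comp_reassoc[OF o'(1)])
  have "Comp A W E E (Comp A E X E a q \<oplus>\<^bsub>Hom A E E\<^esub> d') u = u"
    unfolding d' using ar by (simp add: Comp_rules)
  then have d'u: "Comp A W E E d' u = u"
    using ar d'(1) q(1,3) by (simp add: Comp_rules)
  have "Comp A E E (Zs l) (p l) d' = \<zero>\<^bsub>Hom A E (Zs l)\<^esub>"
    unfolding q(4) using ar q(1) d'(1) o'(2) by (simp add: Comp_rules)
  moreover have "Comp A E E E (Comp A E (Zs l) E (i l) (p l) \<oplus>\<^bsub>Hom A E E\<^esub> Comp A E W E u v) d' = d'"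
    unfolding biproduct_sum[OF B] using d'(1) by (simp add: Comp_rules)
  ultimately have uvd': "Comp A E W E u (Comp A E E W v d') = d'"
    using ar d'(1) by (simp add: Comp_rules)
  have "biproduct A E X W a (Comp A W E E d u) b (Comp A E E W v d')"
    using ar ba d d'(1) dd' d'u by (intro biproductI) (simp_all add: Comp_rules uvd' Comp_reassoc[OF d'd])
  then show ?thesis using that by blast
qed

end

context decomposition
begin

text \<open>
  The summands of \<open>S\<close> are split off \<open>E\<close> one at a time, each from the complement of the
  preceding ones.
\<close>

lemma section_complement:
  assumes ks: "krull_schmidt A" and loc: "\<And>l. l \<in> {1..n} \<Longrightarrow> local_object (Xs l)"
    and a: "arrow A S E a" and b: "arrow A E S b" and ba: "Comp A S E S b a = Idm A S"
  obtains W u v where "biproduct A E S W a u b v"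
proof -
  note ar = a b arrow_Ob[OF a]
  have "\<exists>W u v. arrow A W E u \<and> arrow A E W v \<and> Comp A W E W v u = Idm A W \<and>
      Comp A E S E a (Comp A E S S (proj_on F) b) \<oplus>\<^bsub>Hom A E E\<^esub> Comp A E W E u v = Idm A E"
    if "finite F" "F \<subseteq> {1..n}" for F
    using that
  proof (induction F)
    case empty
    show ?case
      unfolding proj_on_empty using ar
      by (intro exI[of _ E] exI[of _ "Idm A E"]) (simp add: Comp_rules)
  next
    case (insert l F)
    then have l: "l \<in> {1..n}" and F: "F \<subseteq> {1..n}" by auto
    note o = proj_on_orthogonal[OF F l insert.hyps(2)]
    obtain W u v where W: "arrow A W E u" "arrow A E W v" "Comp A W E W v u = Idm A W"
      and sum: "Comp A E S E a (Comp A E S S (proj_on F) b) \<oplus>\<^bsub>Hom A E E\<^esub> Comp A E W E u v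
        = Idm A E" using insert.IH[OF F] by blast
    note ar = ar W arrow_Ob[OF W(1)] arrow_i[OF l] arrow_p[OF l] Xs[OF l] arrow_proj_on[OF F]
    \<comment> \<open>\<open>u v\<close> acts as the identity on the summand \<open>l\<close>, by orthogonality\<close>
    let ?a = "Comp A (Xs l) S E a (i l)" and ?b = "Comp A E S (Xs l) (p l) b"
    have "Comp A (Xs l) E E (Comp A E S E a (Comp A E S S (proj_on F) b) \<oplus>\<^bsub>Hom A E E\<^esub>
        Comp A E W E u v) ?a = ?a"
      unfolding sum using ar by (simp add: Comp_rules)
    then have uva: "Comp A (Xs l) W E u (Comp A (Xs l) E W v ?a) = ?a"
      using ar by (simp add: Comp_rules Comp_reassoc[OF ba] o)
    have "Comp A E E (Xs l) ?b (Comp A E S E a (Comp A E S S (proj_on F) b) \<oplus>\<^bsub>Hom A E E\<^esub>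
        Comp A E W E u v) = ?b"
      unfolding sum using ar by (simp add: Comp_rules)
    then have buv: "Comp A E E (Xs l) ?b (Comp A E W E u v) = ?b"
      using ar by (simp add: Comp_rules Comp_reassoc[OF ba] Comp_reassoc[OF o(1)])
    let ?x = "Comp A (Xs l) E W v ?a" and ?y = "Comp A W E (Xs l) ?b u"
    have "Comp A (Xs l) W (Xs l) ?y ?x = Comp A (Xs l) E (Xs l) ?b (Comp A (Xs l) W E u ?x)"
      using ar by (simp add: Comp_rules)
    also have "\<dots> = Idm A (Xs l)"
      unfolding uva using ar p_i[OF l l] by (simp add: Comp_rules Comp_reassoc[OF ba])
    finally have yx: "Comp A (Xs l) W (Xs l) ?y ?x = Idm A (Xs l)" .
    have xy: "arrow A (Xs l) W ?x" "arrow A W (Xs l) ?y"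
      using ar by (simp_all add: arrow_rules)
    obtain W' u' v' where B: "biproduct A W (Xs l) W' ?x u' ?y v'"
      using local_section_complement[OF ks loc[OF l] xy yx] .
    note ar = ar biproductD(2,4,6,11)[OF B]
    let ?u = "Comp A W' W E u u'" and ?v = "Comp A E W W' v' v"
    have "Comp A E W E u v = Comp A E W E u (Comp A E W W (Comp A W (Xs l) W ?x ?y
        \<oplus>\<^bsub>Hom A W W\<^esub> Comp A W W' W u' v') v)"
      unfolding biproduct_sum[OF B] using ar by (simp add: Comp_rules)
    also have "\<dots> = Comp A E (Xs l) E (Comp A (Xs l) W E u ?x)
        (Comp A E E (Xs l) ?b (Comp A E W E u v)) \<oplus>\<^bsub>Hom A E E\<^esub> Comp A E W' E ?u ?v"
      using ar by (simp add: Comp_rules)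
    finally have uv: "Comp A E W E u v
        = Comp A E (Xs l) E ?a ?b \<oplus>\<^bsub>Hom A E E\<^esub> Comp A E W' E ?u ?v"
      unfolding uva buv .
    have "Comp A W' E W' ?v ?u = Idm A W'"
      using ar by (simp add: Comp_rules Comp_reassoc[OF W(3)])
    moreover have "Comp A E S E a (Comp A E S S (proj_on (insert l F)) b)
        \<oplus>\<^bsub>Hom A E E\<^esub> Comp A E W' E ?u ?v = Idm A E"
      unfolding sum[symmetric] uv proj_on_insert[OF insert.hyps(2) insert.prems]
      using ar by (simp add: Comp_rules add_ac)
    ultimately show ?case
      using ar by (intro exI[of _ W'] exI[of _ ?u] exI[of _ ?v]) (simp add: arrow_rules)
  qed
  from this[of "{1..n}"] obtain W u v where W: "arrow A W E u" "arrow A E W v"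
    "Comp A W E W v u = Idm A W"
    "Comp A E S E a (Comp A E S S (proj_on {1..n}) b) \<oplus>\<^bsub>Hom A E E\<^esub> Comp A E W E u v = Idm A E"
    by auto
  then have "Comp A E S E a b \<oplus>\<^bsub>Hom A E E\<^esub> Comp A E W E u v = Idm A E"
    unfolding proj_on_all using ar by (simp add: Comp_rules)
  then show ?thesis
    using that[OF biproductI[OF a W(1) b W(2) ba W(3)]] by blast
qed

end


section \<open>Ideals and quotient categories\<close>

locale category_ideal = k_category k A
  for k :: "('k, 'r) ring_scheme" and A :: "('o, 'm, 'k) kcat" +
  fixes I :: "'o \<Rightarrow> 'o \<Rightarrow> 'm set"
  assumes ideal: "cat_ideal k A I"
begin

lemma submodule_ideal: "X \<in> Ob A \<Longrightarrow> Y \<in> Ob A \<Longrightarrow> submodule (I X Y) k (Hom A X Y)"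
  using ideal by (simp add: cat_ideal_def)

lemma arrow_ideal:
  assumes "X \<in> Ob A" "Y \<in> Ob A" "r \<in> I X Y"
  shows "arrow A X Y r"
  using module.submoduleE(1)[OF module_Hom submodule_ideal] assms unfolding arrow_def by blast

lemma ideal_add:
  assumes "X \<in> Ob A" "Y \<in> Ob A" "r \<in> I X Y" "s \<in> I X Y"
  shows "r \<oplus>\<^bsub>Hom A X Y\<^esub> s \<in> I X Y"
  using module.submoduleE(5)[OF module_Hom submodule_ideal] assms by blast

lemma ideal_negative:
  assumes "X \<in> Ob A" "Y \<in> Ob A" "r \<in> I X Y"
  obtains s where "s \<in> I X Y" "r \<oplus>\<^bsub>Hom A X Y\<^esub> s = \<zero>\<^bsub>Hom A X Y\<^esub>"
proof
  interpret abelian_group "Hom A X Y" using abelian_group_Hom assms by blast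
  show "\<ominus>\<^bsub>Hom A X Y\<^esub> r \<in> I X Y"
    using module.submoduleE(3)[OF module_Hom submodule_ideal] assms by blast
  show "r \<oplus>\<^bsub>Hom A X Y\<^esub> \<ominus>\<^bsub>Hom A X Y\<^esub> r = \<zero>\<^bsub>Hom A X Y\<^esub>"
    using arrow_ideal[OF assms] r_neg by (simp add: arrow_def)
qed

lemma ideal_zero:
  assumes "X \<in> Ob A" "Y \<in> Ob A"
  shows "\<zero>\<^bsub>Hom A X Y\<^esub> \<in> I X Y"
proof -
  obtain r where r: "r \<in> I X Y"
    using module.submoduleE(2)[OF module_Hom submodule_ideal] assms by blast
  then show ?thesis using ideal_negative[OF assms r] ideal_add[OF assms] by metis
qed

lemma ideal_Comp_left: "\<lbrakk>X \<in> Ob A; f \<in> I X Y; arrow A Y Z g\<rbrakk> \<Longrightarrow> Comp A X Y Z g f \<in> I X Z"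
  using ideal arrow_Ob unfolding cat_ideal_def by blast

lemma ideal_Comp_right: "\<lbrakk>Z \<in> Ob A; arrow A X Y f; g \<in> I Y Z\<rbrakk> \<Longrightarrow> Comp A X Y Z g f \<in> I X Z"
  using ideal arrow_Ob unfolding cat_ideal_def by blast

abbreviation Q :: "('o, 'm set, 'k) kcat" where
  "Q \<equiv> quotient_category A I"

abbreviation res :: "'o \<Rightarrow> 'o \<Rightarrow> 'm \<Rightarrow> 'm set" where
  "res X Y f \<equiv> residue A I X Y f"

lemma residue_iff: "x \<in> res X Y f \<longleftrightarrow> (\<exists>r\<in>I X Y. x = r \<oplus>\<^bsub>Hom A X Y\<^esub> f)"
  unfolding residue_def a_r_coset_def' by auto

lemma residue_self: "arrow A X Y f \<Longrightarrow> f \<in> res X Y f"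
  unfolding residue_iff using ideal_zero[of X Y] add_zero_left arrow_Ob by metis

lemma residue_subset:
  assumes f: "arrow A X Y f" and g: "arrow A X Y g" and r: "r \<in> I X Y"
    and eq: "g \<oplus>\<^bsub>Hom A X Y\<^esub> r = f"
  shows "res X Y f \<subseteq> res X Y g"
proof
  note ob = arrow_Ob[OF f]
  fix x assume "x \<in> res X Y f"
  then obtain s where s: "s \<in> I X Y" "x = s \<oplus>\<^bsub>Hom A X Y\<^esub> f" by (auto simp: residue_iff)
  have "x = (s \<oplus>\<^bsub>Hom A X Y\<^esub> r) \<oplus>\<^bsub>Hom A X Y\<^esub> g"
    unfolding s(2) eq[symmetric] using g arrow_ideal[OF ob r] arrow_ideal[OF ob s(1)]
    by (simp add: arrow_rules add_ac)
  then show "x \<in> res X Y g" unfolding residue_iff using ideal_add[OF ob s(1) r] by blast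
qed

lemma residue_eq_iff:
  assumes f: "arrow A X Y f" and g: "arrow A X Y g"
  shows "res X Y f = res X Y g \<longleftrightarrow> (\<exists>r\<in>I X Y. f \<oplus>\<^bsub>Hom A X Y\<^esub> r = g)"
proof
  note ob = arrow_Ob[OF f]
  assume "res X Y f = res X Y g"
  then obtain r where r: "r \<in> I X Y" "g = r \<oplus>\<^bsub>Hom A X Y\<^esub> f"
    using residue_self[OF g] residue_iff by blast
  have "f \<oplus>\<^bsub>Hom A X Y\<^esub> r = g"
    unfolding r(2) by (rule add_commute[OF f arrow_ideal[OF ob r(1)]])
  then show "\<exists>r\<in>I X Y. f \<oplus>\<^bsub>Hom A X Y\<^esub> r = g" using r(1) by blast
next
  note ob = arrow_Ob[OF f]
  assume "\<exists>r\<in>I X Y. f \<oplus>\<^bsub>Hom A X Y\<^esub> r = g"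
  then obtain r where r: "r \<in> I X Y" "f \<oplus>\<^bsub>Hom A X Y\<^esub> r = g" by blast
  obtain s where s: "s \<in> I X Y" "r \<oplus>\<^bsub>Hom A X Y\<^esub> s = \<zero>\<^bsub>Hom A X Y\<^esub>"
    using ideal_negative[OF ob r(1)] .
  have "g \<oplus>\<^bsub>Hom A X Y\<^esub> s = f"
    unfolding r(2)[symmetric]
    using add_assoc[OF f arrow_ideal[OF ob r(1)] arrow_ideal[OF ob s(1)]] s(2) add_zero_right[OF f]
    by simp
  then show "res X Y f = res X Y g"
    using residue_subset[OF f g s(1)] residue_subset[OF g f r(1,2)] by blast
qed

lemma Idm_quotient: "Idm Q X = res X X (Idm A X)"
  by (simp add: quotient_category_def)

lemma arrow_quotient: "arrow Q X Y F \<longleftrightarrow> (\<exists>f. arrow A X Y f \<and> F = res X Y f)"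
  by (auto simp: arrow_def quotient_category_def A_RCOSETS_def' residue_def)

lemma Comp_quotient:
  assumes f: "arrow A X Y f" and g: "arrow A Y Z g"
  shows "Comp Q X Y Z (res Y Z g) (res X Y f) = res X Z (Comp A X Y Z g f)"
proof -
  note ob = arrow_Ob[OF f] arrow_Ob[OF g]
  have "res X Z (Comp A X Y Z g' f') = res X Z (Comp A X Y Z g f)"
    if g': "g' \<in> res Y Z g" and f': "f' \<in> res X Y f" for f' g'
  proof -
    obtain r where r: "r \<in> I Y Z" "g' = r \<oplus>\<^bsub>Hom A Y Z\<^esub> g" using g' residue_iff by blast
    obtain s where s: "s \<in> I X Y" "f' = s \<oplus>\<^bsub>Hom A X Y\<^esub> f" using f' residue_iff by blast
    note ar = f g ob arrow_ideal[OF _ _ r(1)] arrow_ideal[OF _ _ s(1)]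
    have f'a: "arrow A X Y f'" unfolding s(2) using ar by (simp add: arrow_rules)
    have "Comp A X Y Z g' f' = Comp A X Y Z g f \<oplus>\<^bsub>Hom A X Z\<^esub>
        (Comp A X Y Z g s \<oplus>\<^bsub>Hom A X Z\<^esub> Comp A X Y Z r f')"
      unfolding r(2) s(2) using ar by (simp add: Comp_rules add_ac)
    moreover have "Comp A X Y Z g s \<oplus>\<^bsub>Hom A X Z\<^esub> Comp A X Y Z r f' \<in> I X Z"
      using ob f'a r(1) s(1) g by (intro ideal_add ideal_Comp_left ideal_Comp_right)
    moreover have "arrow A X Z (Comp A X Y Z g' f')"
      unfolding r(2) using ar f'a by (simp add: arrow_rules)
    ultimately show ?thesis
      using residue_eq_iff[OF arrow_Comp[OF f g]] by metis
  qed
  note const = this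
  have "Comp Q X Y Z (res Y Z g) (res X Y f)
      = (\<Union>g'\<in>res Y Z g. \<Union>f'\<in>res X Y f. res X Z (Comp A X Y Z g' f'))"
    by (simp add: quotient_category_def)
  also have "\<dots> = (\<Union>g'\<in>res Y Z g. \<Union>f'\<in>res X Y f. res X Z (Comp A X Y Z g f))"
    by (intro SUP_cong refl const)
  also have "\<dots> = res X Z (Comp A X Y Z g f)"
    using residue_self[OF f] residue_self[OF g] by blast
  finally show ?thesis .
qed

lemma is_retraction_quotient:
  assumes f: "arrow A X Y f"
  shows "is_retraction Q X Y (res X Y f) \<longleftrightarrow>
    (\<exists>s r. arrow A Y X s \<and> r \<in> I Y Y \<and> Comp A Y X Y f s \<oplus>\<^bsub>Hom A Y Y\<^esub> r = Idm A Y)"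
proof -
  have "Comp Q Y X Y (res X Y f) (res Y X s) = Idm Q Y \<longleftrightarrow>
      (\<exists>r\<in>I Y Y. Comp A Y X Y f s \<oplus>\<^bsub>Hom A Y Y\<^esub> r = Idm A Y)" if s: "arrow A Y X s" for s
    unfolding Comp_quotient[OF s f] Idm_quotient
    using residue_eq_iff arrow_Comp[OF s f] arrow_Idm arrow_Ob[OF f] by blast
  then show ?thesis
    unfolding is_retraction_def arrow_quotient using f by blast
qed

lemma is_section_quotient:
  assumes f: "arrow A X Y f"
  shows "is_section Q X Y (res X Y f) \<longleftrightarrow>
    (\<exists>s r. arrow A Y X s \<and> r \<in> I X X \<and> Comp A X Y X s f \<oplus>\<^bsub>Hom A X X\<^esub> r = Idm A X)"
proof -
  have "Comp Q X Y X (res Y X s) (res X Y f) = Idm Q X \<longleftrightarrow>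
      (\<exists>r\<in>I X X. Comp A X Y X s f \<oplus>\<^bsub>Hom A X X\<^esub> r = Idm A X)" if s: "arrow A Y X s" for s
    unfolding Comp_quotient[OF f s] Idm_quotient
    using residue_eq_iff arrow_Comp[OF f s] arrow_Idm arrow_Ob[OF f] by blast
  then show ?thesis
    unfolding is_section_def arrow_quotient using f by blast
qed

lemma factorization_quotient:
  assumes f: "arrow A X Y f" and g: "arrow A Y Z g" and h: "arrow A X Z h"
  shows "res X Z h = Comp Q X Y Z (res Y Z g) (res X Y f) \<longleftrightarrow>
    (\<exists>r\<in>I X Z. Comp A X Y Z g f \<oplus>\<^bsub>Hom A X Z\<^esub> r = h)"
  unfolding Comp_quotient[OF f g] by (subst eq_commute) (rule residue_eq_iff[OF arrow_Comp[OF f g] h])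

lemma right_almost_split_quotient:
  assumes f: "arrow A X Y f"
  shows "right_almost_split Q X Y (res X Y f) \<longleftrightarrow> \<not> is_retraction Q X Y (res X Y f) \<and>
    (\<forall>U u. arrow A U Y u \<longrightarrow> \<not> is_retraction Q U Y (res U Y u) \<longrightarrow>
      (\<exists>v r. arrow A U X v \<and> r \<in> I U Y \<and> Comp A U X Y f v \<oplus>\<^bsub>Hom A U Y\<^esub> r = u))"
proof -
  have "(\<exists>V. arrow Q U X V \<and> res U Y u = Comp Q U X Y (res X Y f) V) \<longleftrightarrow>
      (\<exists>v r. arrow A U X v \<and> r \<in> I U Y \<and> Comp A U X Y f v \<oplus>\<^bsub>Hom A U Y\<^esub> r = u)"
    if u: "arrow A U Y u" for U u
    unfolding arrow_quotient using factorization_quotient[OF _ f u] by blast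
  note factor = this
  have "(\<forall>U u. arrow Q U Y u \<longrightarrow> \<not> is_retraction Q U Y u \<longrightarrow>
        (\<exists>V. arrow Q U X V \<and> u = Comp Q U X Y (res X Y f) V)) \<longleftrightarrow>
      (\<forall>U u. arrow A U Y u \<longrightarrow> \<not> is_retraction Q U Y (res U Y u) \<longrightarrow>
        (\<exists>V. arrow Q U X V \<and> res U Y u = Comp Q U X Y (res X Y f) V))"
    unfolding arrow_quotient[of _ Y] by blast
  moreover have "arrow Q X Y (res X Y f)" using f arrow_quotient by blast
  ultimately show ?thesis
    unfolding right_almost_split_def using factor by simp
qed

lemma irreducible_quotient:
  assumes f: "arrow A X Y f"
  shows "irreducible_arrow Q X Y (res X Y f) \<longleftrightarrow>
    \<not> is_section Q X Y (res X Y f) \<and> \<not> is_retraction Q X Y (res X Y f) \<and>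
    (\<forall>M g h r. arrow A X M g \<longrightarrow> arrow A M Y h \<longrightarrow> r \<in> I X Y \<longrightarrow>
      Comp A X M Y h g \<oplus>\<^bsub>Hom A X Y\<^esub> r = f \<longrightarrow>
      is_retraction Q M Y (res M Y h) \<or> is_section Q X M (res X M g))"
proof -
  have "(\<forall>M G H. arrow Q X M G \<longrightarrow> arrow Q M Y H \<longrightarrow> res X Y f = Comp Q X M Y H G \<longrightarrow>
        is_retraction Q M Y H \<or> is_section Q X M G) \<longleftrightarrow>
      (\<forall>M g h. arrow A X M g \<longrightarrow> arrow A M Y h \<longrightarrow>
        res X Y f = Comp Q X M Y (res M Y h) (res X M g) \<longrightarrow>
        is_retraction Q M Y (res M Y h) \<or> is_section Q X M (res X M g))"
    unfolding arrow_quotient by blast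
  also have "\<dots> \<longleftrightarrow> (\<forall>M g h r. arrow A X M g \<longrightarrow> arrow A M Y h \<longrightarrow> r \<in> I X Y \<longrightarrow>
      Comp A X M Y h g \<oplus>\<^bsub>Hom A X Y\<^esub> r = f \<longrightarrow>
      is_retraction Q M Y (res M Y h) \<or> is_section Q X M (res X M g))"
    using factorization_quotient[OF _ _ f] by blast
  finally show ?thesis
    unfolding irreducible_arrow_def using f arrow_quotient by blast
qed


section \<open>Ideals inside the radical\<close>

text \<open>The ideal at \<open>X\<close> lies in the Jacobson radical of the endomorphism ring; \<open>t\<close> is \<open>1 - r\<close>.\<close>

definition ideal_in_radical :: "'o \<Rightarrow> bool" where
  "ideal_in_radical X \<longleftrightarrow>
    (\<forall>r\<in>I X X. \<forall>t. arrow A X X t \<longrightarrow> r \<oplus>\<^bsub>Hom A X X\<^esub> t = Idm A X \<longrightarrow> is_iso A X X t)"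

lemma local_ideal_in_radical:
  assumes X: "local_object X" and I1: "Idm A X \<notin> I X X"
  shows "ideal_in_radical X"
  unfolding ideal_in_radical_def
proof (intro ballI allI impI)
  fix r t assume r: "r \<in> I X X" and t: "arrow A X X t" "r \<oplus>\<^bsub>Hom A X X\<^esub> t = Idm A X"
  have Xo: "X \<in> Ob A" using X by (simp add: local_object_def)
  have "\<not> is_iso A X X r"
  proof
    assume "is_iso A X X r"
    then obtain s where "arrow A X X s" "Comp A X X X s r = Idm A X" using is_isoD by metis
    then show False using ideal_Comp_left[OF Xo r] I1 by metis
  qed
  then show "is_iso A X X t"
    using X arrow_ideal[OF Xo Xo r] t unfolding local_object_def by blast
qed

lemma retraction_from_quotient:
  assumes Y: "ideal_in_radical Y" and f: "arrow A X Y f" and ret: "is_retraction Q X Y (res X Y f)"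
  shows "is_retraction A X Y f"
proof -
  note ob = arrow_Ob[OF f]
  obtain s r where s: "arrow A Y X s" and r: "r \<in> I Y Y"
    and fs: "Comp A Y X Y f s \<oplus>\<^bsub>Hom A Y Y\<^esub> r = Idm A Y"
    using ret is_retraction_quotient[OF f] by blast
  have "r \<oplus>\<^bsub>Hom A Y Y\<^esub> Comp A Y X Y f s = Idm A Y"
    using fs add_commute[OF arrow_Comp[OF s f] arrow_ideal[OF ob(2,2) r]] by simp
  then have "is_iso A Y Y (Comp A Y X Y f s)"
    using Y r arrow_Comp[OF s f] unfolding ideal_in_radical_def by blast
  then obtain w where w: "arrow A Y Y w" "Comp A Y Y Y (Comp A Y X Y f s) w = Idm A Y"
    using is_isoD by metis
  then show ?thesis
    unfolding is_retraction_def using Comp_assoc[OF w(1) s f] arrow_Comp[OF w(1) s] f by metis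
qed

lemma section_from_quotient:
  assumes X: "ideal_in_radical X" and f: "arrow A X Y f" and sec: "is_section Q X Y (res X Y f)"
  shows "is_section A X Y f"
proof -
  note ob = arrow_Ob[OF f]
  obtain s r where s: "arrow A Y X s" and r: "r \<in> I X X"
    and fs: "Comp A X Y X s f \<oplus>\<^bsub>Hom A X X\<^esub> r = Idm A X"
    using sec is_section_quotient[OF f] by blast
  have "r \<oplus>\<^bsub>Hom A X X\<^esub> Comp A X Y X s f = Idm A X"
    using fs add_commute[OF arrow_Comp[OF f s] arrow_ideal[OF ob(1,1) r]] by simp
  then have "is_iso A X X (Comp A X Y X s f)"
    using X r arrow_Comp[OF f s] unfolding ideal_in_radical_def by blast
  then obtain w where w: "arrow A X X w" "Comp A X X X w (Comp A X Y X s f) = Idm A X"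
    using is_isoD by metis
  then show ?thesis
    unfolding is_section_def using Comp_assoc[OF f s w(1)] arrow_Comp[OF s w(1)] f by metis
qed

lemma retraction_to_quotient:
  assumes "is_retraction A X Y f"
  shows "is_retraction Q X Y (res X Y f)"
proof -
  obtain s where f: "arrow A X Y f" and s: "arrow A Y X s" "Comp A Y X Y f s = Idm A Y"
    using assms by (auto simp: is_retraction_def)
  note ob = arrow_Ob[OF f]
  have "Comp A Y X Y f s \<oplus>\<^bsub>Hom A Y Y\<^esub> \<zero>\<^bsub>Hom A Y Y\<^esub> = Idm A Y"
    unfolding s(2) by (rule add_zero_right[OF arrow_Idm[OF ob(2)]])
  then show ?thesis
    unfolding is_retraction_quotient[OF f] using s(1) ideal_zero[OF ob(2,2)] by blast
qed

text \<open>
  If the ideal is in the radical at every summand \<open>X\<^sub>l\<close> of \<open>S\<close>, it is in the radical at \<open>S\<close>.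
  The identity of \<open>S\<close> in \<open>1 - r\<close> is built up from the summands: with
  \<open>t = 1 - r (\<Sum>\<^bsub>l \<in> F\<^esub> i\<^sub>l p\<^sub>l)\<close> invertible, passing to one more summand \<open>l\<close> gives
  \<open>t (1 - x y)\<close> with \<open>x = t\<^sup>-\<^sup>1 r i\<^sub>l\<close> and \<open>y = p\<^sub>l\<close>, where \<open>1 - y x\<close> is an endomorphism
  of \<open>X\<^sub>l\<close> congruent to the identity, hence invertible, so that \<open>1 - x y\<close> is invertible too.
\<close>

lemma direct_sum_ideal_in_radical:
  assumes "direct_sum A S n Xs" and rad: "\<And>l. l \<in> {1..n} \<Longrightarrow> ideal_in_radical (Xs l)"
  shows "ideal_in_radical S"
proof -
  obtain i p where "decomposition k A S n Xs i p"
    using direct_sum_decomposition[OF assms(1)] .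
  then interpret decomposition k A S n Xs i p .
  have "\<forall>t. arrow A S S t \<longrightarrow> Comp A S S S r (proj_on F) \<oplus>\<^bsub>Hom A S S\<^esub> t = Idm A S \<longrightarrow>
      is_iso A S S t" if r: "r \<in> I S S" and "finite F" "F \<subseteq> {1..n}" for r F
    using that(2,3)
  proof (induction F)
    case empty
    have "is_iso A S S (Idm A S)"
      unfolding is_iso_def using S arrow_Idm Comp_Idm_left by blast
    then show ?case
      unfolding proj_on_empty using S arrow_ideal[OF S S r] by (auto simp: Comp_rules)
  next
    case (insert l F)
    then have l: "l \<in> {1..n}" and F: "F \<subseteq> {1..n}" by auto
    note ar = arrow_i[OF l] arrow_p[OF l] Xs[OF l] S arrow_proj_on[OF F] arrow_ideal[OF S S r]
    show ?case
    proof (intro allI impI)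
      fix t' assume t': "arrow A S S t'"
        "Comp A S S S r (proj_on (insert l F)) \<oplus>\<^bsub>Hom A S S\<^esub> t' = Idm A S"
      let ?e = "Comp A S (Xs l) S (i l) (p l)"
      let ?t = "Comp A S S S r ?e \<oplus>\<^bsub>Hom A S S\<^esub> t'"
      have t: "arrow A S S ?t" using ar t' by (simp add: arrow_rules)
      have "Comp A S S S r (proj_on F) \<oplus>\<^bsub>Hom A S S\<^esub> ?t = Idm A S"
        unfolding t'(2)[symmetric] proj_on_insert[OF insert.hyps(2) insert.prems]
        using ar t'(1) by (simp add: Comp_rules add_ac)
      then have ti: "is_iso A S S ?t" using insert.IH[OF F] t by blast
      then obtain w where w: "arrow A S S w" "Comp A S S S w ?t = Idm A S"
        "Comp A S S S ?t w = Idm A S" using is_isoD by metis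
      let ?x = "Comp A (Xs l) S S w (Comp A (Xs l) S S r (i l))"
      have x: "arrow A (Xs l) S ?x" using ar w(1) by (simp add: arrow_rules)
      have "Comp A (Xs l) S (Xs l) (p l) ?x \<in> I (Xs l) (Xs l)"
        using ar w(1) r by (intro ideal_Comp_left ideal_Comp_right)
      moreover obtain z where z: "arrow A (Xs l) (Xs l) z"
        "Comp A (Xs l) S (Xs l) (p l) ?x \<oplus>\<^bsub>Hom A (Xs l) (Xs l)\<^esub> z = Idm A (Xs l)"
        using ex_difference[OF arrow_Comp[OF x ar(2)] arrow_Idm[OF ar(3)]] by blast
      ultimately have "is_iso A (Xs l) (Xs l) z"
        using rad[OF l] unfolding ideal_in_radical_def by blast
      moreover have "Comp A S (Xs l) S ?x (p l) \<oplus>\<^bsub>Hom A S S\<^esub> Comp A S S S w t' = Idm A S"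
        unfolding w(2)[symmetric] using ar w(1) t'(1) by (simp add: Comp_rules)
      ultimately have wt': "is_iso A S S (Comp A S S S w t')"
        using is_iso_one_minus_swap[OF x ar(2) arrow_Comp[OF t'(1) w(1)]] z(2) by blast
      have "t' = Comp A S S S ?t (Comp A S S S w t')"
        using Comp_assoc[OF t'(1) w(1) t] w(3) Comp_Idm_left[OF t'(1)] by simp
      then show "is_iso A S S t'" using is_iso_Comp[OF wt' ti] by simp
    qed
  qed
  from this[of _ "{1..n}"] show ?thesis
    unfolding ideal_in_radical_def proj_on_all
    using arrow_ideal[OF S S] Comp_Idm_right by auto
qed


section \<open>Right almost split morphisms modulo an admissible ideal\<close>

lemma retraction_if_quotient_zero:
  assumes f: "arrow A X Y f" and Y: "Idm A Y \<in> I Y Y"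
  shows "is_retraction Q X Y (res X Y f)"
proof -
  note ob = arrow_Ob[OF f]
  have "Comp A Y X Y f \<zero>\<^bsub>Hom A Y X\<^esub> \<oplus>\<^bsub>Hom A Y Y\<^esub> Idm A Y = Idm A Y"
    using f ob by (simp add: Comp_rules)
  then show ?thesis
    unfolding is_retraction_quotient[OF f] using Y arrow_zero[OF ob(2,1)] by blast
qed

text \<open>
  If none of the inclusions of the summands \<open>Y\<^sub>j\<close> were a retraction, all of them, and hence the
  identity of \<open>Y\<close>, would factor through \<open>f\<close> modulo the ideal.
\<close>

lemma almost_split_target_indecomposable:
  assumes Y: "direct_sum A Y m Ys" and ind: "\<And>j. j \<in> {1..m} \<Longrightarrow> indecomposable A (Ys j)"
    and rad: "ideal_in_radical Y" and f: "arrow A X Y f"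
    and split: "right_almost_split Q X Y (res X Y f)"
  shows "indecomposable A Y"
proof -
  obtain i p where "decomposition k A Y m Ys i p"
    using direct_sum_decomposition[OF Y] .
  then interpret decomposition k A Y m Ys i p .
  have nret: "\<not> is_retraction Q X Y (res X Y f)"
    and factor: "\<And>U u. arrow A U Y u \<Longrightarrow> \<not> is_retraction Q U Y (res U Y u) \<Longrightarrow>
      \<exists>v r. arrow A U X v \<and> r \<in> I U Y \<and> Comp A U X Y f v \<oplus>\<^bsub>Hom A U Y\<^esub> r = u"
    using split unfolding right_almost_split_quotient[OF f] by blast+
  have "\<exists>j\<in>{1..m}. is_retraction Q (Ys j) Y (res (Ys j) Y (i j))"
  proof (rule ccontr)
    assume no: "\<not> ?thesis"
    have "\<exists>c r. arrow A Y X c \<and> r \<in> I Y Y \<and> Comp A Y X Y f c \<oplus>\<^bsub>Hom A Y Y\<^esub> r = proj_on F"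
      if "finite F" "F \<subseteq> {1..m}" for F
      using that
    proof (induction F)
      case empty
      show ?case
        unfolding proj_on_empty using f S ideal_zero[OF S S] arrow_Ob[OF f]
        by (intro exI[of _ "\<zero>\<^bsub>Hom A Y X\<^esub>"] exI[of _ "\<zero>\<^bsub>Hom A Y Y\<^esub>"]) (simp add: Comp_rules)
    next
      case (insert l F)
      then have l: "l \<in> {1..m}" and F: "F \<subseteq> {1..m}" by auto
      obtain c r where c: "arrow A Y X c" "r \<in> I Y Y"
        "Comp A Y X Y f c \<oplus>\<^bsub>Hom A Y Y\<^esub> r = proj_on F" using insert.IH[OF F] by blast
      obtain v s where v: "arrow A (Ys l) X v" "s \<in> I (Ys l) Y"
        "Comp A (Ys l) X Y f v \<oplus>\<^bsub>Hom A (Ys l) Y\<^esub> s = i l"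
        using factor[OF arrow_i[OF l]] no l by blast
      note ar = f S Xs[OF l] arrow_p[OF l] c(1) v(1) arrow_ideal[OF S S c(2)]
        arrow_ideal[OF Xs[OF l] S v(2)]
      let ?c = "Comp A Y (Ys l) X v (p l) \<oplus>\<^bsub>Hom A Y X\<^esub> c"
      let ?r = "Comp A Y (Ys l) Y s (p l) \<oplus>\<^bsub>Hom A Y Y\<^esub> r"
      have "Comp A Y X Y f ?c \<oplus>\<^bsub>Hom A Y Y\<^esub> ?r = proj_on (insert l F)"
        unfolding proj_on_insert[OF insert.hyps(2) insert.prems] c(3)[symmetric] v(3)[symmetric]
        using ar by (simp add: Comp_rules add_ac)
      moreover have "?r \<in> I Y Y"
        using S c(2) ideal_Comp_right[OF S arrow_p[OF l] v(2)] by (intro ideal_add)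
      moreover have "arrow A Y X ?c" using ar by (simp add: arrow_rules)
      ultimately show ?case by blast
    qed
    from this[of "{1..m}"] have "is_retraction Q X Y (res X Y f)"
      unfolding is_retraction_quotient[OF f] proj_on_all by simp
    then show False using nret by blast
  qed
  then obtain j where j: "j \<in> {1..m}" "is_retraction A (Ys j) Y (i j)"
    using retraction_from_quotient[OF rad arrow_i] by blast
  then obtain s where s: "arrow A Y (Ys j) s" "Comp A Y (Ys j) Y (i j) s = Idm A Y"
    by (auto simp: is_retraction_def)
  have pi: "Comp A (Ys j) Y (Ys j) (p j) (i j) = Idm A (Ys j)"
    using p_i[OF j(1) j(1)] by simp
  have "Comp A Y Y (Ys j) (p j) (Comp A Y (Ys j) Y (i j) s) = s"
    using s(1) arrow_i[OF j(1)] arrow_p[OF j(1)] by (simp add: Comp_rules Comp_reassoc[OF pi])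
  then have "p j = s"
    unfolding s(2) using Comp_Idm_right[OF arrow_p[OF j(1)]] by simp
  then show ?thesis
    using indecomposable_iso[OF ind[OF j(1)] arrow_i[OF j(1)] arrow_p[OF j(1)] pi] s(2) by blast
qed

lemma ideal_factors_through_minimal_right_almost_split:
  assumes "admissible_ideal k A I" "minimal_right_almost_split A E Y e" "Idm A Y \<notin> I Y Y"
    "M \<in> Ob A" "r \<in> I M Y"
  obtains h where "h \<in> I M E" "r = Comp A M E Y e h"
  using assms unfolding admissible_ideal_def by blast

text \<open>
  Let \<open>e = (f g)\<close> be minimal right almost split. Every non-retraction modulo the ideal is one in
  the category itself, so it factors as \<open>f v + g v'\<close>, and \<open>g v'\<close> vanishes modulo the ideal.
  If \<open>f\<close> is \<open>h g'\<close> modulo the ideal and \<open>h\<close> is no retraction, then \<open>h = f a\<close>, and \<open>f\<close> agrees with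
  \<open>f a g'\<close> up to a morphism that admissibility writes as \<open>e h'\<close>. Right minimality of \<open>e\<close>
  makes \<open>a g'\<close> an isomorphism modulo the ideal.
\<close>

lemma irreducible_and_almost_split_quotient:
  assumes adm: "admissible_ideal k A I" and radX: "ideal_in_radical X" and radY: "ideal_in_radical Y"
    and X: "Idm A X \<notin> I X X" and f: "arrow A X Y f" and g: "arrow A X' Y g"
    and X': "Idm A X' \<in> I X' X'" and B: "biproduct A S X X' i i' p p'"
    and split: "minimal_right_almost_split A S Y (row A S X X' p p' Y f g)"
  shows "irreducible_arrow Q X Y (res X Y f) \<and> right_almost_split Q X Y (res X Y f)"
proof -
  define e where "e = row A S X X' p p' Y f g"
  note ar = f g arrow_Ob[OF f] biproductD[OF B]
  have ea: "arrow A S Y e" "e = Comp A S X Y f p \<oplus>\<^bsub>Hom A S Y\<^esub> Comp A S X' Y g p'"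
    unfolding e_def row_def using ar by (simp_all add: arrow_rules)
  have ei: "Comp A X S Y e i = f" and ei': "Comp A X' S Y e i' = g"
    unfolding ea(2) using ar by (simp_all add: Comp_rules)
  have nret: "\<not> is_retraction A S Y e"
    and factor: "\<And>U u. arrow A U Y u \<Longrightarrow> \<not> is_retraction A U Y u \<Longrightarrow>
      \<exists>v. arrow A U S v \<and> u = Comp A U S Y e v"
    and minimal: "\<And>\<phi>. arrow A S S \<phi> \<Longrightarrow> Comp A S S Y e \<phi> = e \<Longrightarrow> is_iso A S S \<phi>"
    using split unfolding e_def[symmetric] minimal_right_almost_split_def right_almost_split_def
      right_minimal_def by blast+
  have Y: "Idm A Y \<notin> I Y Y"
    using retraction_from_quotient[OF radY ea(1)] retraction_if_quotient_zero[OF ea(1)] nret by blast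
  have fnret: "\<not> is_retraction A X Y f"
  proof
    assume "is_retraction A X Y f"
    then obtain s where s: "arrow A Y X s" "Comp A Y X Y f s = Idm A Y"
      by (auto simp: is_retraction_def)
    have "Comp A Y S Y e (Comp A Y X S i s) = Idm A Y"
      using Comp_reassoc[OF ei] ar ea(1) s by simp
    then show False
      using nret ea(1) arrow_Comp[OF s(1) ar(5)] unfolding is_retraction_def by blast
  qed
  have fnretQ: "\<not> is_retraction Q X Y (res X Y f)"
    using fnret retraction_from_quotient[OF radY f] by blast
  have factorQ: "\<exists>v r. arrow A U X v \<and> r \<in> I U Y \<and> Comp A U X Y f v \<oplus>\<^bsub>Hom A U Y\<^esub> r = u"
    if u: "arrow A U Y u" "\<not> is_retraction Q U Y (res U Y u)" for U u
  proof -
    obtain v where v: "arrow A U S v" "u = Comp A U S Y e v"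
      using factor[OF u(1)] u(2) retraction_to_quotient by blast
    note av = arrow_Ob[OF v(1)] arrow_Comp[OF v(1) ar(7)] arrow_Comp[OF v(1) ar(8)]
    have "Comp A U X' X' (Idm A X') (Comp A U S X' p' v) \<in> I U X'"
      by (rule ideal_Comp_right[OF ar(14) av(4) X'])
    then have "Comp A U X' Y g (Comp A U S X' p' v) \<in> I U Y"
      using ideal_Comp_left[OF av(1) _ g] Comp_Idm_left[OF av(4)] by simp
    moreover have "Comp A U X Y f (Comp A U S X p v) \<oplus>\<^bsub>Hom A U Y\<^esub> Comp A U X' Y g (Comp A U S X' p' v) = u"
      unfolding v(2) ea(2) using ar v(1) by (simp add: Comp_rules)
    ultimately show ?thesis using av by blast
  qed
  have "\<not> is_section A X Y f"
  proof
    assume "is_section A X Y f"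
    then obtain s where s: "arrow A Y X s" "Comp A X Y X s f = Idm A X"
      by (auto simp: is_section_def)
    obtain d where d: "arrow A Y Y d" "Comp A Y X Y f s \<oplus>\<^bsub>Hom A Y Y\<^esub> d = Idm A Y"
      using ex_difference[OF arrow_Comp[OF s(1) f] arrow_Idm[OF ar(4)]] by blast
    note o = complement_orthogonal[OF f s(1) d(1) s(2) d(2)]
    show False
    proof (cases "is_retraction A Y Y d")
      case True
      then obtain z where z: "arrow A Y Y z" "Comp A Y Y Y d z = Idm A Y"
        by (auto simp: is_retraction_def)
      have "s = Comp A Y Y X s (Comp A Y Y Y d z)"
        unfolding z(2) using s by (simp add: Comp_rules)
      also have "\<dots> = \<zero>\<^bsub>Hom A Y X\<^esub>"
        using o(2) s(1) z(1) d(1) ar by (simp add: Comp_rules Comp_reassoc[OF o(2)])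
      finally have "Idm A X = \<zero>\<^bsub>Hom A X X\<^esub>"
        using s(2) Comp_zero_left[OF f ar(3)] by simp
      then show False using X ideal_zero[OF ar(3) ar(3)] by simp
    next
      case False
      then obtain v where v: "arrow A Y S v" "d = Comp A Y S Y e v"
        using factor[OF d(1)] by blast
      have "Comp A Y S Y e (Comp A Y X S i s \<oplus>\<^bsub>Hom A Y S\<^esub> v) = Idm A Y"
        unfolding d(2)[symmetric] v(2) using ar ea(1) s(1) v(1)
        by (simp add: Comp_rules Comp_reassoc[OF ei])
      then show False
        using nret ea(1) v(1) ar s(1) unfolding is_retraction_def by (blast intro: arrow_rules)
    qed
  qed
  then have fnsecQ: "\<not> is_section Q X Y (res X Y f)"
    using section_from_quotient[OF radX f] by blast
  have "is_section Q X M (res X M g')"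
    if g': "arrow A X M g'" and h: "arrow A M Y h" and r: "r \<in> I X Y"
      and hg: "Comp A X M Y h g' \<oplus>\<^bsub>Hom A X Y\<^esub> r = f"
      and hn: "\<not> is_retraction Q M Y (res M Y h)" for M g' h r
  proof -
    obtain a s where a: "arrow A M X a" "s \<in> I M Y"
      "Comp A M X Y f a \<oplus>\<^bsub>Hom A M Y\<^esub> s = h" using factorQ[OF h hn] by blast
    have as: "arrow A M Y s" by (rule arrow_ideal[OF arrow_Ob(1)[OF h] ar(4) a(2)])
    have r': "Comp A X M Y s g' \<oplus>\<^bsub>Hom A X Y\<^esub> r \<in> I X Y"
      using ar r ideal_Comp_right[OF ar(4) g' a(2)] by (intro ideal_add)
    obtain h' where h': "h' \<in> I X S" "Comp A X M Y s g' \<oplus>\<^bsub>Hom A X Y\<^esub> r = Comp A X S Y e h'"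
      using ideal_factors_through_minimal_right_almost_split[OF adm _ Y ar(3) r'] split
      unfolding e_def[symmetric] by blast
    note ar = ar ea(1) g' h a(1) as arrow_ideal[OF ar(3,4) r] arrow_ideal[OF ar(3,15) h'(1)]
    let ?a = "Comp A X M X a g'"
    have fa: "Comp A X X Y f ?a \<oplus>\<^bsub>Hom A X Y\<^esub> Comp A X S Y e h' = f"
      unfolding h'(2)[symmetric] using hg unfolding a(3)[symmetric] using ar
      by (simp add: Comp_rules add_assoc)
    \<comment> \<open>\<open>\<phi>\<close> has the matrix \<open>(a g' + h'\<^sub>1, 0; h'\<^sub>2, 1)\<close> for \<open>h' = (h'\<^sub>1, h'\<^sub>2)\<close>\<close>
    define \<phi> where "\<phi> = Comp A S X S (Comp A X X S i ?a \<oplus>\<^bsub>Hom A X S\<^esub> h') p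
      \<oplus>\<^bsub>Hom A S S\<^esub> Comp A S X' S i' p'"
    have \<phi>: "arrow A S S \<phi>" unfolding \<phi>_def using ar by (simp add: arrow_rules)
    have "Comp A S S Y e \<phi> = Comp A S X Y (Comp A X X Y f ?a \<oplus>\<^bsub>Hom A X Y\<^esub> Comp A X S Y e h') p
        \<oplus>\<^bsub>Hom A S Y\<^esub> Comp A S X' Y g p'"
      unfolding \<phi>_def using ar by (simp add: Comp_rules Comp_reassoc[OF ei] Comp_reassoc[OF ei'])
    then have "Comp A S S Y e \<phi> = e" unfolding fa ea(2)[symmetric] .
    then obtain \<psi> where \<psi>: "arrow A S S \<psi>" "Comp A S S S \<psi> \<phi> = Idm A S"
      using minimal[OF \<phi>] is_isoD by metis
    have "Comp A X S S \<phi> i = Comp A X X S i ?a \<oplus>\<^bsub>Hom A X S\<^esub> h'"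
      unfolding \<phi>_def using ar by (simp add: Comp_rules)
    then have "Comp A X S S \<psi> (Comp A X X S i ?a \<oplus>\<^bsub>Hom A X S\<^esub> h') = i"
      using Comp_reassoc[OF \<psi>(2) \<phi> \<psi>(1)] ar Comp_Idm_left by metis
    then have "Comp A X S X p (Comp A X S S \<psi> (Comp A X X S i ?a \<oplus>\<^bsub>Hom A X S\<^esub> h')) = Idm A X"
      using ar by simp
    then have "Comp A X M X (Comp A M S X p (Comp A M S S \<psi> (Comp A M X S i a))) g'
        \<oplus>\<^bsub>Hom A X X\<^esub> Comp A X S X p (Comp A X S S \<psi> h') = Idm A X"
      using ar \<psi>(1) by (simp add: Comp_rules)
    moreover have "Comp A X S X p (Comp A X S S \<psi> h') \<in> I X X"
      using ar \<psi>(1) h'(1) by (intro ideal_Comp_left)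
    moreover have "arrow A M X (Comp A M S X p (Comp A M S S \<psi> (Comp A M X S i a)))"
      using ar \<psi>(1) by (simp add: arrow_rules)
    ultimately show ?thesis
      unfolding is_section_quotient[OF g'] by blast
  qed
  then show ?thesis
    unfolding irreducible_quotient[OF f] right_almost_split_quotient[OF f]
    using fnretQ fnsecQ factorQ by blast
qed

text \<open>
  Let \<open>e : E \<rightarrow> Y\<close> be minimal right almost split, and \<open>f = e a\<close>. As \<open>f\<close> is irreducible modulo
  the ideal and \<open>e\<close> is no retraction there, \<open>a\<close> is a section, so \<open>E = X \<oplus> W\<close> and \<open>e = (f g)\<close>.
  As \<open>f\<close> is right almost split modulo the ideal, \<open>g\<close> factors through \<open>f\<close> up to a morphism that
  admissibility writes as \<open>e h\<close> with \<open>h\<close> in the ideal. Replacing \<open>g\<close> by this expression is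
  right multiplication of \<open>e\<close> by an endomorphism, invertible by right minimality, which is
  zero modulo the ideal in its last diagonal entry; this forces \<open>1\<^sub>W\<close> into the ideal.
\<close>

lemma minimal_right_almost_split_extension:
  assumes adm: "admissible_ideal k A I" and ks: "krull_schmidt A"
    and X: "direct_sum A X n Xs" and loc: "\<And>l. l \<in> {1..n} \<Longrightarrow> local_object (Xs l)"
    and radX: "ideal_in_radical X" and radY: "ideal_in_radical Y" and f: "arrow A X Y f"
    and split: "minimal_right_almost_split A E Y e"
    and irr: "irreducible_arrow Q X Y (res X Y f)"
    and splitQ: "right_almost_split Q X Y (res X Y f)"
  shows "\<exists>W g u i p q. arrow A W Y g \<and> Idm A W \<in> I W W \<and> biproduct A E X W i u p q \<and>
    minimal_right_almost_split A E Y (row A E X W p q Y f g)"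
proof -
  have e: "arrow A E Y e" and nret: "\<not> is_retraction A E Y e"
    and factor: "\<And>U u. arrow A U Y u \<Longrightarrow> \<not> is_retraction A U Y u \<Longrightarrow>
      \<exists>v. arrow A U E v \<and> u = Comp A U E Y e v"
    and minimal: "\<And>\<phi>. arrow A E E \<phi> \<Longrightarrow> Comp A E E Y e \<phi> = e \<Longrightarrow> is_iso A E E \<phi>"
    using split unfolding minimal_right_almost_split_def right_almost_split_def
      right_minimal_def by blast+
  have fnret: "\<not> is_retraction Q X Y (res X Y f)"
    using irr unfolding irreducible_quotient[OF f] by blast
  have Y: "Idm A Y \<notin> I Y Y" using fnret retraction_if_quotient_zero[OF f] by blast
  note ob = arrow_Ob[OF f] arrow_Ob(1)[OF e]
  obtain a where a: "arrow A X E a" "f = Comp A X E Y e a"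
    using factor[OF f] fnret retraction_to_quotient by blast
  have "Comp A X E Y e a \<oplus>\<^bsub>Hom A X Y\<^esub> \<zero>\<^bsub>Hom A X Y\<^esub> = f"
    unfolding a(2)[symmetric] by (rule add_zero_right[OF f])
  then have "is_retraction Q E Y (res E Y e) \<or> is_section Q X E (res X E a)"
    using irr a(1) e ideal_zero[OF ob(1,2)] unfolding irreducible_quotient[OF f] by blast
  then have "is_section A X E a"
    using retraction_from_quotient[OF radY e] nret section_from_quotient[OF radX a(1)] by blast
  then obtain b where b: "arrow A E X b" "Comp A X E X b a = Idm A X"
    by (auto simp: is_section_def)
  obtain i p where d: "decomposition k A X n Xs i p"
    using direct_sum_decomposition[OF X] .
  obtain W u v where B: "biproduct A E X W a u b v"
    using decomposition.section_complement[OF d ks loc a(1) b] .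
  define g where "g = Comp A W E Y e u"
  note ar = f e ob biproductD[OF B]
  have g: "arrow A W Y g" unfolding g_def using ar by (simp add: arrow_rules)
  have e_eq: "Comp A E X Y f b \<oplus>\<^bsub>Hom A E Y\<^esub> Comp A E W Y g v = e"
  proof -
    have "Comp A E E Y e (Comp A E X E a b \<oplus>\<^bsub>Hom A E E\<^esub> Comp A E W E u v) = e"
      unfolding biproduct_sum[OF B] by (rule Comp_Idm_right[OF e])
    then show ?thesis unfolding g_def a(2) using ar by (simp add: Comp_rules)
  qed
  have gnret: "\<not> is_retraction Q W Y (res W Y g)"
  proof
    assume "is_retraction Q W Y (res W Y g)"
    then obtain s where s: "arrow A Y W s" "Comp A Y W Y g s = Idm A Y"
      using retraction_from_quotient[OF radY g] by (auto simp: is_retraction_def)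
    then have "Comp A Y E Y e (Comp A Y W E u s) = Idm A Y"
      unfolding g_def using ar by (simp add: Comp_rules)
    then show False
      using nret e arrow_Comp[OF s(1) ar(7)] unfolding is_retraction_def by blast
  qed
  obtain c r where c: "arrow A W X c" and r: "r \<in> I W Y"
    and gc: "Comp A W X Y f c \<oplus>\<^bsub>Hom A W Y\<^esub> r = g"
    using splitQ g gnret unfolding right_almost_split_quotient[OF f] by blast
  obtain h where h: "h \<in> I W E" "r = Comp A W E Y e h"
    using ideal_factors_through_minimal_right_almost_split[OF adm split Y _ r] ar by blast
  note ar = ar g c arrow_ideal[OF _ _ h(1)]
  define \<phi> where "\<phi> = Comp A E X E a b \<oplus>\<^bsub>Hom A E E\<^esub>
    Comp A E W E (Comp A W X E a c \<oplus>\<^bsub>Hom A W E\<^esub> h) v"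
  have \<phi>: "arrow A E E \<phi>" unfolding \<phi>_def using ar by (simp add: arrow_rules)
  have "Comp A E E Y e \<phi> = Comp A E X Y f b \<oplus>\<^bsub>Hom A E Y\<^esub>
      Comp A E W Y (Comp A W X Y f c \<oplus>\<^bsub>Hom A W Y\<^esub> r) v"
    unfolding \<phi>_def h(2) using ar by (simp add: Comp_rules Comp_reassoc[OF a(2)[symmetric]])
  then have "Comp A E E Y e \<phi> = e" unfolding gc e_eq .
  then obtain \<psi> where \<psi>: "arrow A E E \<psi>" "Comp A E E E \<phi> \<psi> = Idm A E"
    using minimal[OF \<phi>] is_isoD by metis
  have W: "W \<in> Ob A" using biproductD(10)[OF B] .
  have va: "Comp A X E W v a = \<zero>\<^bsub>Hom A X W\<^esub>" using biproductD(8)[OF B] .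
  have "Comp A E E W v \<phi> = Comp A E W W (Comp A W E W v h) v"
    unfolding \<phi>_def using ar by (simp add: Comp_rules Comp_reassoc[OF va])
  moreover have "Comp A W E W v (Comp A W E E (Comp A E E E \<phi> \<psi>) u) = Idm A W"
    unfolding \<psi>(2) using ar by (simp add: Comp_rules)
  then have "Comp A W E W (Comp A E E W v \<phi>) (Comp A W E E \<psi> u) = Idm A W"
    using ar \<phi> \<psi>(1) by (simp add: Comp_rules)
  ultimately have "Comp A W E W (Comp A E W W (Comp A W E W v h) v) (Comp A W E E \<psi> u) = Idm A W"
    by simp
  moreover have "Comp A W E W (Comp A E W W (Comp A W E W v h) v) (Comp A W E E \<psi> u) \<in> I W W"
    by (rule ideal_Comp_right[OF W arrow_Comp[OF biproductD(2)[OF B] \<psi>(1)]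
          ideal_Comp_right[OF W biproductD(4)[OF B] ideal_Comp_left[OF W h(1) biproductD(4)[OF B]]]])
  ultimately have "Idm A W \<in> I W W" by simp
  moreover have "row A E X W b v Y f g = e" unfolding row_def by (rule e_eq)
  ultimately show ?thesis using g B split by metis
qed

end

theorem proposition4p17:
  fixes k :: "('k, 'r) ring_scheme"
    and A :: "('o, 'm, 'k) kcat"
    and I :: "'o \<Rightarrow> 'o \<Rightarrow> 'm set"
    and X Y :: 'o and f :: 'm
    and n m :: nat and Xs Ys :: "nat \<Rightarrow> 'o"
  assumes "left_AR_category k A"
    and "arrow A X Y f"
    and "admissible_ideal k A I"
    and "n \<ge> 1"
    and "direct_sum A X n Xs"
    and "direct_sum A Y m Ys"
    and "\<forall>i\<in>{1..n}. indecomposable A (Xs i) \<and> Idm A (Xs i) \<notin> I (Xs i) (Xs i)"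
    and "\<forall>j\<in>{1..m}. indecomposable A (Ys j) \<and> Idm A (Ys j) \<notin> I (Ys j) (Ys j)"
  shows "(irreducible_arrow (quotient_category A I) X Y (residue A I X Y f) \<and>
          right_almost_split (quotient_category A I) X Y (residue A I X Y f))
     \<longleftrightarrow>
         (\<exists>X' g. arrow A X' Y g \<and> Idm A X' \<in> I X' X' \<and>
            (\<exists>S i i' p p'. biproduct A S X X' i i' p p' \<and>
               minimal_right_almost_split A S Y (row A S X X' p p' Y f g)))"
proof -
  interpret category_ideal k A I
    using assms(1,3)
    by (auto simp: left_AR_category_def admissible_ideal_def category_ideal_def category_ideal_axioms_def)
  have ks: "krull_schmidt A" using assms(1) by (simp add: left_AR_category_def)
  have locX: "local_object (Xs l)" if "l \<in> {1..n}" for l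
    using indecomposable_local[OF ks] assms(7) that by blast
  have radX: "ideal_in_radical X"
    using direct_sum_ideal_in_radical[OF assms(5)] local_ideal_in_radical locX assms(7) by blast
  have radY: "ideal_in_radical Y"
    using direct_sum_ideal_in_radical[OF assms(6)] local_ideal_in_radical
      indecomposable_local[OF ks] assms(8) by blast
  show ?thesis
  proof
    assume Q: "irreducible_arrow Q X Y (res X Y f) \<and> right_almost_split Q X Y (res X Y f)"
    have "indecomposable A Y"
      using almost_split_target_indecomposable[OF assms(6) _ radY assms(2)] Q assms(8) by blast
    then obtain E e where "minimal_right_almost_split A E Y e"
      using assms(1) unfolding left_AR_category_def pseudo_projective_def AR_sequence_def by blast
    from minimal_right_almost_split_extension[OF assms(3) ks assms(5) locX radX radY assms(2) this] Q
    show "\<exists>X' g. arrow A X' Y g \<and> Idm A X' \<in> I X' X' \<and>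
        (\<exists>S i i' p p'. biproduct A S X X' i i' p p' \<and>
           minimal_right_almost_split A S Y (row A S X X' p p' Y f g))" by blast
  next
    obtain i p where "decomposition k A X n Xs i p"
      using direct_sum_decomposition[OF assms(5)] .
    then interpret X: decomposition k A X n Xs i p .
    have one: "1 \<in> {1..n}" using assms(4) by simp
    have "Idm A X \<notin> I X X"
    proof
      assume "Idm A X \<in> I X X"
      then have "Comp A (Xs 1) X (Xs 1) (p 1) (Comp A (Xs 1) X X (Idm A X) (i 1)) \<in> I (Xs 1) (Xs 1)"
        by (intro ideal_Comp_left ideal_Comp_right X.arrow_i X.arrow_p X.Xs X.S one)
      then show False
        using Comp_Idm_left[OF X.arrow_i[OF one]] X.p_i[OF one one] assms(7) one by simp
    qed
    moreover assume "\<exists>X' g. arrow A X' Y g \<and> Idm A X' \<in> I X' X' \<and>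
        (\<exists>S i i' p p'. biproduct A S X X' i i' p p' \<and>
           minimal_right_almost_split A S Y (row A S X X' p p' Y f g))"
    ultimately show "irreducible_arrow Q X Y (res X Y f) \<and> right_almost_split Q X Y (res X Y f)"
      using irreducible_and_almost_split_quotient[OF assms(3) radX radY _ assms(2)] by blast
  qed
qed

end
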